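(* For any polynomial function $\alpha(n)$, integers $p>1$, $B\ge 1$ and $n\in\{2^{2p+1}pB,\,3^{2p+1}pB,\,4^{2p+1}pB,\dots\}$, there is a $\Theta(n)$-vertex graph $G$ of diameter $2p+2$ and a spanning tree $T\subseteq G$ of height $h$ such that any (even randomized) distributed $\alpha(n)$-approximation algorithm for weighted TAP on instance tree $T$, in the synchronous model where each vertex sends messages of at most $B$ bits to each neighbour per round, requires $\Omega\big((n/(pB))^{\frac12-\frac{1}{2(2p+1)}}\big)$ rounds, and this quantity is $\Omega(h)$.
   Context: Distributed model: network is an undirected connected graph $G$; computation in synchronous rounds in which each vertex may send a $B$-bit message to each neighbour. Weighted TAP: input is a $2$-edge-connected graph $G$ with non-negative edge weights and a rooted spanning tree $T$ of $G$ (each vertex knows its incident tree edges and its parent); output is a set $Aug$ of edges of $G$ with $T\cup Aug$ $2$-edge-connected, each vertex knowing which incident edges are in $Aug$, minimizing total weight. An $\alpha(n)$-approximation outputs an augmentation of weight at most $\alpha(n)$ times the optimum. The height of $T$ is the maximum root-to-vertex distance in $T$. *)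

theory Defs
  imports "HOL-Probability.Probability" "HOL-Computational_Algebra.Polynomial"
begin

section \<open>Finite simple graphs\<close>

text \<open>A graph is given by its vertex set and its edge set; an edge is an unordered pair of
  distinct vertices.  Vertex names double as the identifiers of the distributed model.\<close>

type_synonym edge = "nat set"

definition simple_graph :: "nat set \<Rightarrow> edge set \<Rightarrow> bool" where
  "simple_graph V E \<longleftrightarrow> finite V \<and> (\<forall>e\<in>E. e \<subseteq> V \<and> card e = 2)"

definition is_walk :: "nat set \<Rightarrow> edge set \<Rightarrow> nat list \<Rightarrow> bool" where
  "is_walk V E xs \<longleftrightarrow> xs \<noteq> [] \<and> set xs \<subseteq> V \<and> successively (\<lambda>u v. {u, v} \<in> E) xs"

definition graph_connected :: "nat set \<Rightarrow> edge set \<Rightarrow> bool" where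
  "graph_connected V E \<longleftrightarrow>
     (\<forall>u\<in>V. \<forall>v\<in>V. \<exists>xs. is_walk V E xs \<and> hd xs = u \<and> last xs = v)"

definition graph_dist :: "nat set \<Rightarrow> edge set \<Rightarrow> nat \<Rightarrow> nat \<Rightarrow> nat" where
  "graph_dist V E u v =
     (LEAST l. \<exists>xs. is_walk V E xs \<and> hd xs = u \<and> last xs = v \<and> length xs = Suc l)"

text \<open>Distance, diameter and height are only meaningful for connected nonempty finite graphs.\<close>

definition graph_diameter :: "nat set \<Rightarrow> edge set \<Rightarrow> nat" where
  "graph_diameter V E = Max {graph_dist V E u v | u v. u \<in> V \<and> v \<in> V}"

definition two_edge_connected :: "nat set \<Rightarrow> edge set \<Rightarrow> bool" where
  "two_edge_connected V E \<longleftrightarrow> graph_connected V E \<and> (\<forall>e\<in>E. graph_connected V (E - {e}))"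

definition is_cycle :: "edge set \<Rightarrow> nat list \<Rightarrow> bool" where
  "is_cycle E xs \<longleftrightarrow> 3 \<le> length xs \<and> distinct xs \<and>
     successively (\<lambda>u v. {u, v} \<in> E) xs \<and> {last xs, hd xs} \<in> E"

definition spanning_tree :: "nat set \<Rightarrow> edge set \<Rightarrow> edge set \<Rightarrow> bool" where
  "spanning_tree V E T \<longleftrightarrow> T \<subseteq> E \<and> graph_connected V T \<and> \<not> (\<exists>xs. is_cycle T xs)"

definition tree_height :: "nat set \<Rightarrow> edge set \<Rightarrow> nat \<Rightarrow> nat" where
  "tree_height V T r = Max (graph_dist V T r ` V)"

definition tree_parent :: "nat set \<Rightarrow> edge set \<Rightarrow> nat \<Rightarrow> nat \<Rightarrow> nat option" where
  "tree_parent V T r v =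
     (if v = r then None
      else Some (THE u. {u, v} \<in> T \<and> graph_dist V T r v = Suc (graph_dist V T r u)))"

section \<open>Weighted tree augmentation\<close>

definition tap_topology :: "nat set \<Rightarrow> edge set \<Rightarrow> edge set \<Rightarrow> nat \<Rightarrow> bool" where
  "tap_topology V E T r \<longleftrightarrow>
     simple_graph V E \<and> two_edge_connected V E \<and> spanning_tree V E T \<and> r \<in> V"

definition augmentation :: "nat set \<Rightarrow> edge set \<Rightarrow> edge set \<Rightarrow> edge set \<Rightarrow> bool" where
  "augmentation V E T Aug \<longleftrightarrow> Aug \<subseteq> E \<and> two_edge_connected V (T \<union> Aug)"

definition tap_opt :: "nat set \<Rightarrow> edge set \<Rightarrow> edge set \<Rightarrow> (edge \<Rightarrow> real) \<Rightarrow> real" where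
  "tap_opt V E T w = Min (sum w ` {Aug. augmentation V E T Aug})"

section \<open>Synchronous message passing\<close>

text \<open>What a vertex knows before the first round: its identifier, its neighbours, its incident
  tree edges, its parent, and the weights of its incident edges.  Incident edges are named by
  their other endpoint.\<close>

record tap_input =
  self_id :: nat
  nbrs :: "nat set"
  tree_nbrs :: "nat set"
  parent_id :: "nat option"
  nbr_weight :: "nat \<Rightarrow> real"

definition local_input ::
  "nat set \<Rightarrow> edge set \<Rightarrow> edge set \<Rightarrow> nat \<Rightarrow> (edge \<Rightarrow> real) \<Rightarrow> nat \<Rightarrow> tap_input" where
  "local_input V E T r w v =
     \<lparr> self_id = v,
       nbrs = {u. {u, v} \<in> E},
       tree_nbrs = {u. {u, v} \<in> T},
       parent_id = tree_parent V T r v,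
       nbr_weight = (\<lambda>u. if {u, v} \<in> E then w {u, v} else 0) \<rparr>"

type_synonym message = "bool list"
type_synonym coins = "nat \<Rightarrow> bool"

text \<open>The messages received in one round (indexed by the sender), and the list of these over all
  rounds so far, oldest first.\<close>

type_synonym inbox = "nat \<Rightarrow> message"
type_synonym history = "inbox list"

text \<open>An algorithm is given without an explicit state space: local computation is unrestricted,
  so the message to a neighbour, as well as the final output, is an arbitrary function of
  everything the vertex has seen, namely its input, its coins and the messages received so far.
  The empty bit string stands for sending nothing.  The output is the set of neighbours
  joined to the vertex by an edge of the augmentation.\<close>

record tap_algorithm =
  send :: "tap_input \<Rightarrow> coins \<Rightarrow> history \<Rightarrow> nat \<Rightarrow> message"
  result :: "tap_input \<Rightarrow> coins \<Rightarrow> history \<Rightarrow> nat set"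

definition bandwidth :: "nat \<Rightarrow> tap_algorithm \<Rightarrow> bool" where
  "bandwidth B A \<longleftrightarrow> (\<forall>inp \<rho> h u. length (send A inp \<rho> h u) \<le> B)"

primrec run ::
  "tap_algorithm \<Rightarrow> (nat \<Rightarrow> tap_input) \<Rightarrow> (nat \<Rightarrow> coins) \<Rightarrow> nat \<Rightarrow> nat \<Rightarrow> history" where
  "run A I \<rho> 0 v = []"
| "run A I \<rho> (Suc t) v =
     run A I \<rho> t v @
       [\<lambda>u. if u \<in> nbrs (I v) then send A (I u) (\<rho> u) (run A I \<rho> t u) v else []]"

definition output_after ::
  "tap_algorithm \<Rightarrow> (nat \<Rightarrow> tap_input) \<Rightarrow> (nat \<Rightarrow> coins) \<Rightarrow> nat \<Rightarrow> nat \<Rightarrow> nat set" where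
  "output_after A I \<rho> R v = result A (I v) (\<rho> v) (run A I \<rho> R v)"

text \<open>Both endpoints of an edge have to agree on whether it belongs to the augmentation.\<close>

definition approx_output ::
  "nat set \<Rightarrow> edge set \<Rightarrow> edge set \<Rightarrow> (edge \<Rightarrow> real) \<Rightarrow> real \<Rightarrow> (nat \<Rightarrow> nat set) \<Rightarrow> bool" where
  "approx_output V E T w a out \<longleftrightarrow>
     (\<exists>Aug. augmentation V E T Aug \<and> sum w Aug \<le> a * tap_opt V E T w \<and>
            (\<forall>v\<in>V. out v = {u. {u, v} \<in> Aug}))"

text \<open>Each vertex has its own infinite supply of independent fair coin flips.\<close>

definition coin_space :: "coins measure" where
  "coin_space = PiM UNIV (\<lambda>_. measure_pmf (bernoulli_pmf (1/2)))"

definition randomness :: "nat set \<Rightarrow> (nat \<Rightarrow> coins) measure" where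
  "randomness V = PiM V (\<lambda>_. coin_space)"

text \<open>Bounded-error algorithms with worst-case round complexity at most \<open>R\<close>: whatever the
  weights, the outputs after \<open>R\<close> rounds are a correct approximation except with probability
  \<open>\<epsilon>\<close>.  A vertex that decides earlier just keeps its decision; deterministic algorithms ignore
  the coins.  For \<open>\<epsilon> < 1\<close> the inequality forces the success event to be measurable, as
  \<^const>\<open>measure\<close> vanishes on non-measurable sets.  The topology is fixed and only the weights
  vary: the algorithm may be tailored to the graph and the tree.

  Correctness is demanded for the integer weights in \<open>{0..W}\<close> only.  Demanding it for all
  non-negative reals would be a stronger requirement on the algorithm, and one which cannot be
  met in boundedly many rounds in general, since comparing arbitrary reals held by two
  vertices takes an unbounded number of bits.\<close>

definition approximates_in_rounds ::
  "nat set \<Rightarrow> edge set \<Rightarrow> edge set \<Rightarrow> nat \<Rightarrow> nat \<Rightarrow> real \<Rightarrow> real \<Rightarrow> tap_algorithm \<Rightarrow> nat \<Rightarrow> bool"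
  where
  "approximates_in_rounds V E T r W a \<epsilon> A R \<longleftrightarrow>
     (\<forall>w. (\<forall>e\<in>E. w e \<in> \<nat> \<and> w e \<le> real W) \<longrightarrow>
        measure (randomness V)
          {\<rho> \<in> space (randomness V).
             approx_output V E T w a (output_after A (local_input V E T r w) \<rho> R)} \<ge> 1 - \<epsilon>)"

end

theory Submission
  imports Defs
begin

text \<open>The weights can be kept in \<open>{0, 1}\<close>, where an approximation of any quality has to recognize
  optimum \<open>0\<close>.  Take \<open>m\<close> long paths whose vertices are joined to the leaves of a \<open>k\<close>-ary tree, and
  let every path hang on the rest of the spanning tree by a single edge.  Only two further edges
  into the path can be free, one at either end, and they are priced by the two players of a set
  disjointness problem on \<open>m\<close> points: the optimum is \<open>0\<close> iff no path is expensive at both ends.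

  As long as the number of rounds is below the length of the paths, information gets from one end
  to the other only through the tree, which yields a protocol that exchanges few bits.  Disjointness
  however requires linearly many: by the level-1 inequality a short transcript is nearly independent
  of most coordinates of the input, and by the cut-and-paste property of rectangles it then cannot
  tell a coordinate in both sets from one in neither.  Taking \<open>m\<close> large in terms of \<open>\<epsilon>\<close> makes the
  argument work for every error below \<open>1/2\<close>, including the case of no communication at all.\<close>

section \<open>Randomized set disjointness\<close>

text \<open>Graphs are simple, so a tree edge cannot be covered by a parallel copy; instead the
  edges of the tree and of the paths are closed into free triangles. The price is that information
  moves two positions per round along a path, whence the factors 2 and 4 below. The parameters come
  from counting. In each round either front of what is known lies over one position of the paths,
  and only the \<open>p\<close> inner tree vertices above that position exchange messages across it
  with their \<open>k\<close> children. That is O(pkB) bits per round and O(pkB k^p) over fewer than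
  \<open>k ^ p / 4\<close> rounds, so \<open>m\<close> is a large multiple of
  \<open>k * p * B * k ^ p\<close>; the paths then have Theta(n) vertices, and \<open>k ^ p\<close>
  is the claimed power of n/(pB). No two-party protocol is ever defined. All that is used of the
  messages crossing the fronts is that, for fixed coins, inputs with equal transcripts form a
  rectangle. This is also why the private coins of the vertices can be treated as public.\<close>

lemma sum_Pow_insert_split:
  fixes f :: "'a set \<Rightarrow> real"
  assumes "finite I" "i \<in> I"
  shows "(\<Sum>z\<in>Pow I. f z) = (\<Sum>z\<in>Pow (I - {i}). f z + f (insert i z))"
proof -
  define J where "J = I - {i}"
  have I: "I = insert i J" and J: "finite J" "i \<notin> J" using assms by (auto simp: J_def)
  have "(\<Sum>z\<in>Pow I. f z) = (\<Sum>z\<in>Pow J. f z) + (\<Sum>z\<in>insert i ` Pow J. f z)"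
    unfolding I Pow_insert using J by (intro sum.union_disjoint) auto
  also have "(\<Sum>z\<in>insert i ` Pow J. f z) = (\<Sum>z\<in>Pow J. f (insert i z))"
    using J by (subst sum.reindex) (auto simp: inj_on_def)
  finally show ?thesis by (simp add: J_def sum.distrib)
qed

text \<open>For fixed \<open>d\<close>, a uniform \<open>z\<close> yields the disjoint pair
  \<open>z \<inter> d\<close>, \<open>z - d\<close> with independent members. This turns rectangles
  into products of counts.\<close>

lemma sum_Pow_mult_split:
  fixes f g :: "'a set \<Rightarrow> real"
  assumes "finite J"
  shows "(\<Sum>z\<in>Pow J. f (z \<inter> d) * g (z - d)) = (\<Sum>x\<in>Pow (J \<inter> d). f x) * (\<Sum>y\<in>Pow (J - d). g y)"
proof -
  have "(\<Sum>x\<in>Pow (J \<inter> d). f x) * (\<Sum>y\<in>Pow (J - d). g y)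
      = (\<Sum>(x, y)\<in>Pow (J \<inter> d) \<times> Pow (J - d). f x * g y)"
    by (simp add: sum_product sum.cartesian_product)
  also have "\<dots> = (\<Sum>z\<in>Pow J. f (z \<inter> d) * g (z - d))"
  proof (rule sum.reindex_bij_witness[of _ "\<lambda>z. (z \<inter> d, z - d)" "\<lambda>(x, y). x \<union> y"], goal_cases)
    case (5 a)
    then obtain x y where a: "a = (x, y)" "x \<subseteq> J \<inter> d" "y \<subseteq> J - d" by auto
    then have "(x \<union> y) \<inter> d = x" "(x \<union> y) - d = y" by auto
    then show ?case by (simp add: a)
  qed auto
  finally show ?thesis by simp
qed

text \<open>Any vector of real parameters in place of the biases \<open>b i\<close> gives an exponential moment
  bound on a set of density \<open>\<sigma>\<close> in the cube; half the bias vector is good enough.\<close>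

lemma level_one_inequality:
  fixes I :: "'a set" and S :: "'a set set" and b :: "'a \<Rightarrow> real"
  assumes "finite I" "S \<subseteq> Pow I" "S \<noteq> {}"
  defines "b \<equiv> \<lambda>i. (\<Sum>z\<in>S. if i \<in> z then - 1 else 1) / card S"
  shows "(\<Sum>i\<in>I. (b i)\<^sup>2) \<le> 4 * ln (2 ^ card I / card S)"
proof -
  define sg :: "'a set \<Rightarrow> 'a \<Rightarrow> real" where "sg = (\<lambda>z i. if i \<in> z then - 1 else 1)"
  have fS: "finite S" using assms finite_subset by auto
  have cS: "card S > 0" using fS assms by (simp add: card_gt_0_iff)
  have b: "b i = (\<Sum>z\<in>S. sg z i) / card S" for i by (simp add: b_def sg_def)
  have b1: "\<bar>b i\<bar> \<le> 1" for i
  proof -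
    have "\<bar>\<Sum>z\<in>S. sg z i\<bar> \<le> (\<Sum>z\<in>S. \<bar>sg z i\<bar>)" by (rule sum_abs)
    also have "\<dots> = (\<Sum>z\<in>S. 1)" by (intro sum.cong) (auto simp: sg_def)
    finally show ?thesis using cS by (simp add: b)
  qed
  \<comment> \<open>The sharp exponent is x^2/8, but x^2/4 is easy to get and still leaves half of
    the x^2/2 gained on the other side.\<close>
  have cosh: "exp (x / 2) + exp (- (x / 2)) \<le> 2 * exp (x\<^sup>2 / 4)" if "\<bar>x\<bar> \<le> 1" for x :: real
  proof -
    have *: "exp y + exp (- y) \<le> 2 * exp (y\<^sup>2)" if "0 \<le> y" "y \<le> 1" for y :: real
    proof -
      have "exp y \<le> 1 + y + y\<^sup>2" using that by (rule exp_bound)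
      moreover have "exp (- y) \<le> 1 - y + y\<^sup>2"
      proof -
        have "1 \<le> (1 - y + y\<^sup>2) * (1 + y)"
          using that by (simp add: algebra_simps power2_eq_square)
        also have "\<dots> \<le> (1 - y + y\<^sup>2) * exp y"
          using that by (intro mult_left_mono) (auto simp: exp_ge_add_one_self)
        finally show ?thesis by (simp add: exp_minus field_simps)
      qed
      moreover have "1 + y\<^sup>2 \<le> exp (y\<^sup>2)" by (rule exp_ge_add_one_self)
      ultimately show ?thesis by linarith
    qed
    have "exp (\<bar>x\<bar> / 2) + exp (- (\<bar>x\<bar> / 2)) \<le> 2 * exp ((\<bar>x\<bar> / 2)\<^sup>2)" using that by (intro *) auto
    then show ?thesis by (auto simp: power_divide abs_if split: if_splits)
  qed
  \<comment> \<open>Over \<open>S\<close> the average of \<open>b i * sg z i\<close> is the square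
    of \<open>b i\<close>; Jensen's inequality then takes the average out of the
    exponential.\<close>
  have "exp (\<Sum>i\<in>I. (b i)\<^sup>2 / 2) = exp (\<Sum>z\<in>S. (1 / card S) *\<^sub>R (\<Sum>i\<in>I. b i * sg z i / 2))"
  proof -
    have "(\<Sum>z\<in>S. (1 / card S) *\<^sub>R (\<Sum>i\<in>I. b i * sg z i / 2))
        = (\<Sum>z\<in>S. \<Sum>i\<in>I. (b i / 2) * (sg z i / card S))"
      by (simp add: sum_distrib_left sum_divide_distrib mult_ac)
    also have "\<dots> = (\<Sum>i\<in>I. \<Sum>z\<in>S. (b i / 2) * (sg z i / card S))" by (rule sum.swap)
    also have "\<dots> = (\<Sum>i\<in>I. (b i / 2) * b i)"
      by (simp add: b sum_distrib_left sum_divide_distrib)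
    finally show ?thesis by (simp add: power2_eq_square)
  qed
  also have "\<dots> \<le> (\<Sum>z\<in>S. (1 / card S) * exp (\<Sum>i\<in>I. b i * sg z i / 2))"
    using fS assms cS by (intro convex_on_sum[OF _ _ exp_convex]) auto
  also have "\<dots> = (1 / card S) * (\<Sum>z\<in>S. exp (\<Sum>i\<in>I. b i * sg z i / 2))"
    by (simp add: sum_distrib_left)
  \<comment> \<open>Enlarging \<open>S\<close> to the cube makes the coordinates independent, so the
    moment factorizes. The density of \<open>S\<close> is paid for here.\<close>
  also have "\<dots> \<le> (1 / card S) * (\<Sum>z\<in>Pow I. exp (\<Sum>i\<in>I. b i * sg z i / 2))"
    using assms by (intro mult_left_mono sum_mono2) auto
  also have "(\<Sum>z\<in>Pow I. exp (\<Sum>i\<in>I. b i * sg z i / 2))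
      = (\<Sum>z\<in>Pow I. (\<Prod>i\<in>z. exp (- (b i / 2))) * (\<Prod>i\<in>I - z. exp (b i / 2)))"
  proof (rule sum.cong)
    fix z assume "z \<in> Pow I"
    then have z: "z \<subseteq> I" by simp
    have "(\<Prod>i\<in>I. exp (b i * sg z i / 2))
        = (\<Prod>i\<in>I - z. exp (b i * sg z i / 2)) * (\<Prod>i\<in>z. exp (b i * sg z i / 2))"
      using z assms by (intro prod.subset_diff) auto
    then show "exp (\<Sum>i\<in>I. b i * sg z i / 2)
        = (\<Prod>i\<in>z. exp (- (b i / 2))) * (\<Prod>i\<in>I - z. exp (b i / 2))"
      using assms by (simp add: exp_sum sg_def mult_ac)
  qed simp
  also have "\<dots> = (\<Prod>i\<in>I. exp (- (b i / 2)) + exp (b i / 2))"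
    using assms by (simp add: prod_add)
  also have "\<dots> \<le> (\<Prod>i\<in>I. 2 * exp ((b i)\<^sup>2 / 4))"
  proof (rule prod_mono)
    fix i assume "i \<in> I"
    show "0 \<le> exp (- (b i / 2)) + exp (b i / 2) \<and>
        exp (- (b i / 2)) + exp (b i / 2) \<le> 2 * exp ((b i)\<^sup>2 / 4)"
      using cosh[OF b1[of i]] by (auto intro: add_nonneg_nonneg)
  qed
  also have "\<dots> = 2 ^ card I * exp (\<Sum>i\<in>I. (b i)\<^sup>2 / 4)"
    using assms by (simp add: prod.distrib exp_sum)
  finally have "exp (\<Sum>i\<in>I. (b i)\<^sup>2 / 2) \<le> 2 ^ card I / card S * exp (\<Sum>i\<in>I. (b i)\<^sup>2 / 4)"
    using cS by (simp add: divide_right_mono)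
  then have "ln (exp (\<Sum>i\<in>I. (b i)\<^sup>2 / 2)) \<le> ln (2 ^ card I / card S * exp (\<Sum>i\<in>I. (b i)\<^sup>2 / 4))"
    using cS by (subst ln_le_cancel_iff) auto
  also have "\<dots> = ln (2 ^ card I / card S) + (\<Sum>i\<in>I. (b i)\<^sup>2 / 4)"
    using cS by (subst ln_mult) auto
  finally show ?thesis by (simp add: sum_divide_distrib[symmetric])
qed

section \<open>Hellinger distances of transcript distributions\<close>

lemma sum_of_bool_card:
  "finite A \<Longrightarrow> (\<Sum>x\<in>A. of_bool (P x)) = real (card {x \<in> A. P x})"
  by (simp add: of_bool_def sum.If_cases Collect_conj_eq)

text \<open>Because \<open>(sqrt a + sqrt b)^2\<close> is at least \<open>a + b\<close>. For the
  counts of sets without and with a coordinate, the quotient on the right is the bias to which the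
  level-1 inequality applies.\<close>

lemma sqrt_diff_square_le:
  fixes a b :: real
  assumes "a \<ge> 0" "b \<ge> 0" "a + b > 0"
  shows "(sqrt a - sqrt b)\<^sup>2 \<le> (a + b) * ((a - b) / (a + b))\<^sup>2"
proof -
  have "(sqrt a - sqrt b)\<^sup>2 * (a + b) \<le> (sqrt a - sqrt b)\<^sup>2 * (sqrt a + sqrt b)\<^sup>2"
    using assms by (intro mult_left_mono) (auto simp: power2_sum)
  also have "\<dots> = (a - b)\<^sup>2"
    using assms by (simp add: power_mult_distrib[symmetric] algebra_simps)
  finally have "(sqrt a - sqrt b)\<^sup>2 \<le> (a - b)\<^sup>2 / (a + b)"
    using assms by (simp add: field_simps)
  then show ?thesis using assms by (simp add: power2_eq_square)
qed

text \<open>The classes of equal \<open>T z\<close> partition the cube. The level-1 weight of a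
  class is bounded by the logarithm of its inverse density, and the average of these logarithms is
  an entropy, at most \<open>ln (card F)\<close>.\<close>

lemma sum_hellinger_coordinates_le:
  fixes T :: "'a set \<Rightarrow> 't"
  assumes I: "finite I" and F: "finite F" and T: "\<And>z. z \<subseteq> I \<Longrightarrow> T z \<in> F"
  shows "(\<Sum>i\<in>I. \<Sum>t\<in>F. (sqrt (\<Sum>z\<in>Pow (I - {i}). of_bool (T z = t))
            - sqrt (\<Sum>z\<in>Pow (I - {i}). of_bool (T (insert i z) = t)))\<^sup>2)
         \<le> 2 ^ card I * (4 * ln (card F))"
proof -
  define S where "S = (\<lambda>t. {z \<in> Pow I. T z = t})"
  define b where "b = (\<lambda>t i. (\<Sum>z\<in>S t. if i \<in> z then - 1 else 1) / real (card (S t)))"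
  define c0 c1 where "c0 = (\<lambda>i t. (\<Sum>z\<in>Pow (I - {i}). of_bool (T z = t) :: real))"
    and "c1 = (\<lambda>i t. (\<Sum>z\<in>Pow (I - {i}). of_bool (T (insert i z) = t) :: real))"
  have fS: "finite (S t)" for t using I by (simp add: S_def)
  have nn: "c0 i t \<ge> 0" "c1 i t \<ge> 0" for i t
    by (auto simp: c0_def c1_def intro: sum_nonneg)
  have plus: "c0 i t + c1 i t = card (S t)" if "i \<in> I" for i t
  proof -
    have "real (card (S t)) = (\<Sum>z\<in>Pow I. of_bool (T z = t))"
      unfolding S_def using I by (intro sum_of_bool_card[symmetric]) simp
    then show ?thesis
      using sum_Pow_insert_split[OF I that, of "\<lambda>z. of_bool (T z = t)"]
      by (simp add: c0_def c1_def sum.distrib)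
  qed
  have minus: "c0 i t - c1 i t = (\<Sum>z\<in>S t. if i \<in> z then - 1 else 1)" if "i \<in> I" for i t
  proof -
    have "(\<Sum>z\<in>S t. if i \<in> z then - 1 else 1)
        = (\<Sum>z\<in>Pow I. of_bool (T z = t) * (if i \<in> z then - 1 else 1 :: real))"
      using I by (intro sum.mono_neutral_cong_left) (auto simp: S_def)
    also have "\<dots> = (\<Sum>z\<in>Pow (I - {i}). of_bool (T z = t) - of_bool (T (insert i z) = t))"
      unfolding sum_Pow_insert_split[OF I that] by (intro sum.cong) auto
    finally show ?thesis by (simp add: c0_def c1_def sum_subtractf)
  qed
  have step: "(sqrt (c0 i t) - sqrt (c1 i t))\<^sup>2 \<le> card (S t) * (b t i)\<^sup>2" if "i \<in> I" for i t
  proof (cases "card (S t) = 0")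
    case True
    then have "c0 i t = 0" "c1 i t = 0" using plus[OF that, of t] nn[of i t] by linarith+
    then show ?thesis by simp
  next
    case False
    then have "c0 i t + c1 i t > 0" using plus[OF that, of t] by simp
    from sqrt_diff_square_le[OF nn this] show ?thesis
      by (simp add: plus[OF that] minus[OF that] b_def)
  qed
  have total: "(\<Sum>t\<in>F. real (card (S t))) = 2 ^ card I"
  proof -
    have "(\<Sum>t\<in>F. real (card (S t))) = (\<Sum>t\<in>F. \<Sum>z\<in>Pow I. of_bool (T z = t))"
      unfolding S_def using I by (intro sum.cong refl sum_of_bool_card[symmetric]) simp
    also have "\<dots> = (\<Sum>z\<in>Pow I. \<Sum>t\<in>F. of_bool (T z = t))" by (rule sum.swap)
    also have "\<dots> = (\<Sum>z\<in>Pow I. 1)"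
      using F T by (intro sum.cong) (auto simp: of_bool_def)
    finally show ?thesis using I by (simp add: card_Pow)
  qed
  have cF: "card F > 0" using F T[of "{}"] by (auto simp: card_gt_0_iff)
  \<comment> \<open>The entropy bound, done class by class: \<open>ln u \<le> u - 1\<close> compares
    with the uniform class size \<open>2 ^ card I / card F\<close>, and the linear corrections
    cancel in the sum over \<open>t\<close>.\<close>
  have level: "(\<Sum>i\<in>I. card (S t) * (b t i)\<^sup>2)
      \<le> 4 * (card (S t) * ln (card F) + (2 ^ card I / card F - card (S t)))" for t
  proof (cases "S t = {}")
    case False
    then have c: "card (S t) > 0" using fS by (simp add: card_gt_0_iff)
    have "(\<Sum>i\<in>I. (b t i)\<^sup>2) \<le> 4 * ln (2 ^ card I / card (S t))"
      unfolding b_def using I False by (intro level_one_inequality) (auto simp: S_def)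
    also have "ln (2 ^ card I / card (S t)) = ln (card F) + ln (2 ^ card I / (card F * card (S t)))"
      using c cF by (simp add: ln_mult ln_div)
    also have "ln (2 ^ card I / (card F * card (S t))) \<le> 2 ^ card I / (card F * card (S t)) - 1"
      using c cF by (intro ln_le_minus_one) auto
    finally have "card (S t) * (\<Sum>i\<in>I. (b t i)\<^sup>2)
        \<le> card (S t) * (4 * (ln (card F) + (2 ^ card I / (card F * card (S t)) - 1)))"
      by (intro mult_left_mono) auto
    also have "\<dots> = 4 * (card (S t) * ln (card F) + (2 ^ card I / card F - card (S t)))"
      using c cF by (simp add: field_simps)
    finally show ?thesis by (simp add: sum_distrib_left)
  qed simp
  have "(\<Sum>i\<in>I. \<Sum>t\<in>F. (sqrt (c0 i t) - sqrt (c1 i t))\<^sup>2) \<le> (\<Sum>i\<in>I. \<Sum>t\<in>F. card (S t) * (b t i)\<^sup>2)"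
    by (intro sum_mono step)
  also have "\<dots> = (\<Sum>t\<in>F. \<Sum>i\<in>I. card (S t) * (b t i)\<^sup>2)" by (rule sum.swap)
  also have "\<dots> \<le> (\<Sum>t\<in>F. 4 * (card (S t) * ln (card F) + (2 ^ card I / card F - card (S t))))"
    by (intro sum_mono level)
  also have "\<dots> = 4 * ((\<Sum>t\<in>F. real (card (S t))) * ln (card F)
      + (2 ^ card I - (\<Sum>t\<in>F. real (card (S t)))))"
    using cF by (simp add: sum_distrib_left[symmetric] sum.distrib sum_subtractf
        sum_distrib_right[symmetric])
  also have "\<dots> = 2 ^ card I * (4 * ln (card F))" unfolding total by simp
  finally show ?thesis by (simp add: c0_def c1_def)
qed

text \<open>The Hellinger distance of the product distributions \<open>\<alpha>\<^sub>1 \<beta>\<^sub>0\<close> and \<open>\<alpha>\<^sub>0 \<beta>\<^sub>1\<close> equals that of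
  \<open>\<alpha>\<^sub>0 \<beta>\<^sub>0\<close> and \<open>\<alpha>\<^sub>1 \<beta>\<^sub>1\<close>, and the triangle inequality through \<open>\<alpha>\<^sub>0 \<beta>\<^sub>0\<close>
  bounds the former.\<close>

lemma cut_and_paste:
  fixes \<alpha>\<^sub>0 \<alpha>\<^sub>1 \<beta>\<^sub>0 \<beta>\<^sub>1 :: "'t \<Rightarrow> real"
  assumes F: "finite F" "G \<subseteq> F" and s: "s > 0"
    and nn: "\<And>t. \<alpha>\<^sub>0 t \<ge> 0" "\<And>t. \<alpha>\<^sub>1 t \<ge> 0" "\<And>t. \<beta>\<^sub>0 t \<ge> 0" "\<And>t. \<beta>\<^sub>1 t \<ge> 0"
    and W: "(\<Sum>t\<in>F. \<alpha>\<^sub>0 t * \<beta>\<^sub>0 t) = W" "(\<Sum>t\<in>F. \<alpha>\<^sub>1 t * \<beta>\<^sub>0 t) = W"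
      "(\<Sum>t\<in>F. \<alpha>\<^sub>0 t * \<beta>\<^sub>1 t) = W" "(\<Sum>t\<in>F. \<alpha>\<^sub>1 t * \<beta>\<^sub>1 t) = W"
  shows "(\<Sum>t\<in>G. \<alpha>\<^sub>0 t * \<beta>\<^sub>0 t - \<alpha>\<^sub>1 t * \<beta>\<^sub>1 t)
     \<le> (1 / s) * ((\<Sum>t\<in>F. (sqrt (\<alpha>\<^sub>0 t * \<beta>\<^sub>0 t) - sqrt (\<alpha>\<^sub>1 t * \<beta>\<^sub>0 t))\<^sup>2)
                 + (\<Sum>t\<in>F. (sqrt (\<alpha>\<^sub>0 t * \<beta>\<^sub>0 t) - sqrt (\<alpha>\<^sub>0 t * \<beta>\<^sub>1 t))\<^sup>2)) + 2 * s * W"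
proof -
  define a0 a1 b0 b1 where "a0 = (\<lambda>t. sqrt (\<alpha>\<^sub>0 t))" and "a1 = (\<lambda>t. sqrt (\<alpha>\<^sub>1 t))"
    and "b0 = (\<lambda>t. sqrt (\<beta>\<^sub>0 t))" and "b1 = (\<lambda>t. sqrt (\<beta>\<^sub>1 t))"
  have sq: "\<alpha>\<^sub>0 t = (a0 t)\<^sup>2" "\<alpha>\<^sub>1 t = (a1 t)\<^sup>2" "\<beta>\<^sub>0 t = (b0 t)\<^sup>2" "\<beta>\<^sub>1 t = (b1 t)\<^sup>2"
    and ab: "a0 t \<ge> 0" "a1 t \<ge> 0" "b0 t \<ge> 0" "b1 t \<ge> 0" for t
    using nn by (auto simp: a0_def a1_def b0_def b1_def)
  \<comment> \<open>Both squares have the cross term \<open>- 2 * a0 t * a1 t * b0 t * b1 t\<close>;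
    the remaining terms sum to \<open>2 * W\<close> on either side.\<close>
  have diag: "(\<Sum>t\<in>F. (a0 t * b0 t - a1 t * b1 t)\<^sup>2) = (\<Sum>t\<in>F. (a1 t * b0 t - a0 t * b1 t)\<^sup>2)"
  proof -
    have e: "(a0 t * b0 t - a1 t * b1 t)\<^sup>2 - (a1 t * b0 t - a0 t * b1 t)\<^sup>2
        = \<alpha>\<^sub>0 t * \<beta>\<^sub>0 t + \<alpha>\<^sub>1 t * \<beta>\<^sub>1 t - \<alpha>\<^sub>1 t * \<beta>\<^sub>0 t - \<alpha>\<^sub>0 t * \<beta>\<^sub>1 t" for t
      by (simp add: sq power2_eq_square algebra_simps)
    have "(\<Sum>t\<in>F. (a0 t * b0 t - a1 t * b1 t)\<^sup>2 - (a1 t * b0 t - a0 t * b1 t)\<^sup>2) = 0"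
      unfolding e using W by (simp add: sum.distrib sum_subtractf)
    then show ?thesis by (simp add: sum_subtractf)
  qed
  have tri: "(a1 t * b0 t - a0 t * b1 t)\<^sup>2
      \<le> 2 * (a0 t * b0 t - a1 t * b0 t)\<^sup>2 + 2 * (a0 t * b0 t - a0 t * b1 t)\<^sup>2" for t
  proof -
    have "(y - x)\<^sup>2 \<le> 2 * x\<^sup>2 + 2 * y\<^sup>2" for x y :: real
      using zero_le_power2[of "x + y"] by (simp add: power2_eq_square algebra_simps)
    from this[of "a0 t * b0 t - a0 t * b1 t" "a0 t * b0 t - a1 t * b0 t"] show ?thesis by simp
  qed
  \<comment> \<open>A free parameter \<open>s\<close> in place of Cauchy-Schwarz keeps the bound
    linear in the squared distances, so that it can be summed over coordinates.\<close>
  have amgm: "(x - y) * (x + y) \<le> (x - y)\<^sup>2 / (2 * s) + (s / 2) * (x + y)\<^sup>2" for x y :: real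
  proof -
    have "0 \<le> ((x - y) - s * (x + y))\<^sup>2" by simp
    then have "2 * s * ((x - y) * (x + y)) \<le> (x - y)\<^sup>2 + s * s * (x + y)\<^sup>2"
      by (simp add: power2_eq_square algebra_simps)
    then show ?thesis using s by (simp add: field_simps)
  qed
  have sum2: "(x + y)\<^sup>2 \<le> 2 * x\<^sup>2 + 2 * y\<^sup>2" for x y :: real
    using zero_le_power2[of "x - y"] by (simp add: power2_eq_square algebra_simps)
  have "(\<Sum>t\<in>G. \<alpha>\<^sub>0 t * \<beta>\<^sub>0 t - \<alpha>\<^sub>1 t * \<beta>\<^sub>1 t)
      = (\<Sum>t\<in>G. (a0 t * b0 t - a1 t * b1 t) * (a0 t * b0 t + a1 t * b1 t))"
    by (simp add: sq power2_eq_square algebra_simps)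
  also have "\<dots> \<le> (\<Sum>t\<in>G. (a0 t * b0 t - a1 t * b1 t)\<^sup>2 / (2 * s)
      + (s / 2) * (a0 t * b0 t + a1 t * b1 t)\<^sup>2)"
    by (intro sum_mono amgm)
  also have "\<dots> \<le> (\<Sum>t\<in>F. (a0 t * b0 t - a1 t * b1 t)\<^sup>2 / (2 * s)
      + (s / 2) * (a0 t * b0 t + a1 t * b1 t)\<^sup>2)"
    using F s by (intro sum_mono2) auto
  also have "\<dots> = (\<Sum>t\<in>F. (a0 t * b0 t - a1 t * b1 t)\<^sup>2) / (2 * s)
      + (s / 2) * (\<Sum>t\<in>F. (a0 t * b0 t + a1 t * b1 t)\<^sup>2)"
    by (simp add: sum.distrib sum_divide_distrib sum_distrib_left)
  also have "\<dots> \<le> (\<Sum>t\<in>F. 2 * (a0 t * b0 t - a1 t * b0 t)\<^sup>2 + 2 * (a0 t * b0 t - a0 t * b1 t)\<^sup>2) / (2 * s)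
      + (s / 2) * (\<Sum>t\<in>F. 2 * (a0 t * b0 t)\<^sup>2 + 2 * (a1 t * b1 t)\<^sup>2)"
    unfolding diag using s
    by (intro add_mono divide_right_mono mult_left_mono sum_mono tri sum2) auto
  also have "(\<Sum>t\<in>F. 2 * (a0 t * b0 t)\<^sup>2 + 2 * (a1 t * b1 t)\<^sup>2) = 4 * W"
    using W(1,4) by (simp add: sum.distrib sum_distrib_left[symmetric] sq power_mult_distrib)
  finally show ?thesis
    using s by (simp add: sum.distrib sum_distrib_left[symmetric] real_sqrt_mult a0_def a1_def
        b0_def b1_def field_simps)
qed

text \<open>Off \<open>i\<close> the inputs are \<open>z \<inter> d\<close> and
  \<open>z - d\<close>. Under \<open>T (insert i d)\<close> coordinate \<open>i\<close> belongs to
  the first player, under \<open>T d\<close> to the second, so the two values of \<open>E\<close>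
  compare transcripts for \<open>i\<close> in neither set with those for \<open>i\<close> in one of
  them; \<open>cut_and_paste\<close> passes to \<open>i\<close> in both.\<close>

lemma disjointness_single_coordinate:
  fixes s :: real and \<tau> :: "'a set \<Rightarrow> 'a set \<Rightarrow> 't"
  assumes I: "finite I" "i \<in> I" and d: "d \<subseteq> I - {i}" and F: "finite F" and s: "s > 0"
    and \<tau>: "\<And>x y. x \<subseteq> I \<Longrightarrow> y \<subseteq> I \<Longrightarrow> \<tau> x y \<in> F"
    and rect: "\<And>x y x' y'. x \<subseteq> I \<Longrightarrow> y \<subseteq> I \<Longrightarrow> x' \<subseteq> I \<Longrightarrow> y' \<subseteq> I \<Longrightarrow> \<tau> x y = \<tau> x' y' \<Longrightarrow> \<tau> x y' = \<tau> x y"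
  defines "T \<equiv> \<lambda>d z. \<tau> (z \<inter> d) (z - d)"
  defines "E \<equiv> \<lambda>d. \<Sum>t\<in>F. (sqrt (\<Sum>z\<in>Pow (I - {i}). of_bool (T d z = t))
            - sqrt (\<Sum>z\<in>Pow (I - {i}). of_bool (T d (insert i z) = t)))\<^sup>2"
  shows "(\<Sum>z\<in>Pow (I - {i}). of_bool (g (\<tau> (z \<inter> d) (z - d)))
            - of_bool (g (\<tau> (insert i (z \<inter> d)) (insert i (z - d)))))
        \<le> (1 / s) * (E (insert i d) + E d) + 2 * s * 2 ^ (card I - 1)"
proof -
  define J where "J = I - {i}"
  have J: "finite J" "i \<notin> J" "J \<subseteq> I" and cJ: "card J = card I - 1" and dJ: "d \<subseteq> J" "i \<notin> d"
    using I d by (auto simp: J_def)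
  \<comment> \<open>The sides of the rectangle on which the transcript is \<open>t\<close>.\<close>
  define A B where "A = (\<lambda>t. {x. x \<subseteq> I \<and> (\<exists>y\<subseteq>I. \<tau> x y = t)})"
    and "B = (\<lambda>t. {y. y \<subseteq> I \<and> (\<exists>x\<subseteq>I. \<tau> x y = t)})"
  have AB: "\<tau> x y = t \<longleftrightarrow> x \<in> A t \<and> y \<in> B t" if "x \<subseteq> I" "y \<subseteq> I" for x y t
  proof
    show "\<tau> x y = t \<Longrightarrow> x \<in> A t \<and> y \<in> B t" using that by (auto simp: A_def B_def)
    assume "x \<in> A t \<and> y \<in> B t"
    then obtain x' y' where *: "x' \<subseteq> I" "y' \<subseteq> I" "\<tau> x y' = t" "\<tau> x' y = t"
      by (auto simp: A_def B_def)
    from rect[of x y' x' y] * that show "\<tau> x y = t" by simp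
  qed
  define a b where "a = (\<lambda>e t. \<Sum>x\<in>Pow (J \<inter> d). of_bool (e x \<in> A t) :: real)"
    and "b = (\<lambda>e t. \<Sum>y\<in>Pow (J - d). of_bool (e y \<in> B t) :: real)"
  have nn: "a e t \<ge> 0" "b e t \<ge> 0" for e t by (auto simp: a_def b_def intro: sum_nonneg)
  have prod: "(\<Sum>z\<in>Pow J. of_bool (\<tau> (e (z \<inter> d)) (f (z - d)) = t)) = a e t * b f t"
    if "e = id \<or> e = insert i" "f = id \<or> f = insert i" for e f t
  proof -
    have "(\<Sum>z\<in>Pow J. of_bool (\<tau> (e (z \<inter> d)) (f (z - d)) = t) :: real)
        = (\<Sum>z\<in>Pow J. of_bool (e (z \<inter> d) \<in> A t) * of_bool (f (z - d) \<in> B t))"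
    proof (rule sum.cong)
      fix z assume "z \<in> Pow J"
      then have "e (z \<inter> d) \<subseteq> I" "f (z - d) \<subseteq> I" using that J I by auto
      then show "of_bool (\<tau> (e (z \<inter> d)) (f (z - d)) = t)
          = of_bool (e (z \<inter> d) \<in> A t) * (of_bool (f (z - d) \<in> B t) :: real)"
        by (simp add: AB)
    qed simp
    also have "\<dots> = a e t * b f t"
      unfolding a_def b_def by (rule sum_Pow_mult_split[OF J(1)])
    finally show ?thesis .
  qed
  have total: "(\<Sum>t\<in>F. a e t * b f t) = 2 ^ card J"
    if ef: "e = id \<or> e = insert i" "f = id \<or> f = insert i" for e f
  proof -
    have "(\<Sum>t\<in>F. a e t * b f t)
        = (\<Sum>z\<in>Pow J. \<Sum>t\<in>F. of_bool (\<tau> (e (z \<inter> d)) (f (z - d)) = t))"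
      unfolding prod[OF ef, symmetric] by (rule sum.swap)
    also have "\<dots> = (\<Sum>z\<in>Pow J. 1)"
    proof (rule sum.cong)
      fix z assume "z \<in> Pow J"
      then have "e (z \<inter> d) \<subseteq> I" "f (z - d) \<subseteq> I" using ef J I by auto
      then have "\<tau> (e (z \<inter> d)) (f (z - d)) \<in> F" by (rule \<tau>)
      then show "(\<Sum>t\<in>F. of_bool (\<tau> (e (z \<inter> d)) (f (z - d)) = t)) = (1 :: real)"
        using F by (simp add: of_bool_def)
    qed simp
    finally show ?thesis using J by (simp add: card_Pow)
  qed
  have T1: "(\<Sum>z\<in>Pow J. of_bool (T (insert i d) z = t)) = a id t * b id t" for t
    unfolding prod[of id id t, simplified, symmetric] T_def
  proof (intro sum.cong refl)
    fix z assume "z \<in> Pow J"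
    then have "z \<inter> insert i d = z \<inter> d" "z - insert i d = z - d" using J by auto
    then show "of_bool (\<tau> (z \<inter> insert i d) (z - insert i d) = t)
        = (of_bool (\<tau> (z \<inter> d) (z - d) = t) :: real)" by simp
  qed
  have T2: "(\<Sum>z\<in>Pow J. of_bool (T (insert i d) (insert i z) = t)) = a (insert i) t * b id t" for t
    unfolding prod[of "insert i" id t, simplified, symmetric] T_def
  proof (intro sum.cong refl)
    fix z assume "z \<in> Pow J"
    then have "insert i z \<inter> insert i d = insert i (z \<inter> d)" "insert i z - insert i d = z - d"
      using J by auto
    then show "of_bool (\<tau> (insert i z \<inter> insert i d) (insert i z - insert i d) = t)
        = (of_bool (\<tau> (insert i (z \<inter> d)) (z - d) = t) :: real)" by simp
  qed
  have T3: "(\<Sum>z\<in>Pow J. of_bool (T d z = t)) = a id t * b id t" for t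
    unfolding prod[of id id t, simplified, symmetric] T_def by simp
  have T4: "(\<Sum>z\<in>Pow J. of_bool (T d (insert i z) = t)) = a id t * b (insert i) t" for t
    unfolding prod[of id "insert i" t, simplified, symmetric] T_def
  proof (intro sum.cong refl)
    fix z assume "z \<in> Pow J"
    then have "insert i z \<inter> d = z \<inter> d" "insert i z - d = insert i (z - d)" using dJ by auto
    then show "of_bool (\<tau> (insert i z \<inter> d) (insert i z - d) = t)
        = (of_bool (\<tau> (z \<inter> d) (insert i (z - d)) = t) :: real)" by simp
  qed
  define G where "G = {t \<in> F. g t}"
  have gsum: "(\<Sum>z\<in>Pow J. of_bool (g (\<tau> (e (z \<inter> d)) (f (z - d)))) :: real)
      = (\<Sum>t\<in>G. a e t * b f t)"
    if ef: "e = id \<or> e = insert i" "f = id \<or> f = insert i" for e f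
  proof -
    have "(\<Sum>t\<in>G. a e t * b f t)
        = (\<Sum>z\<in>Pow J. \<Sum>t\<in>G. of_bool (\<tau> (e (z \<inter> d)) (f (z - d)) = t))"
      unfolding prod[OF ef, symmetric] by (rule sum.swap)
    also have "\<dots> = (\<Sum>z\<in>Pow J. of_bool (g (\<tau> (e (z \<inter> d)) (f (z - d)))))"
    proof (rule sum.cong)
      fix z assume "z \<in> Pow J"
      then have "e (z \<inter> d) \<subseteq> I" "f (z - d) \<subseteq> I" using ef J I by auto
      then have "\<tau> (e (z \<inter> d)) (f (z - d)) \<in> F" by (rule \<tau>)
      then show "(\<Sum>t\<in>G. of_bool (\<tau> (e (z \<inter> d)) (f (z - d)) = t))
          = (of_bool (g (\<tau> (e (z \<inter> d)) (f (z - d)))) :: real)"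
        using F by (simp add: of_bool_def G_def)
    qed simp
    finally show ?thesis by simp
  qed
  have "(\<Sum>z\<in>Pow J. of_bool (g (\<tau> (z \<inter> d) (z - d)))
            - of_bool (g (\<tau> (insert i (z \<inter> d)) (insert i (z - d)))))
      = (\<Sum>t\<in>G. a id t * b id t - a (insert i) t * b (insert i) t)"
    using gsum[of id id] gsum[of "insert i" "insert i"] by (simp add: sum_subtractf)
  also have "\<dots> \<le> (1 / s) * ((\<Sum>t\<in>F. (sqrt (a id t * b id t) - sqrt (a (insert i) t * b id t))\<^sup>2)
                 + (\<Sum>t\<in>F. (sqrt (a id t * b id t) - sqrt (a id t * b (insert i) t))\<^sup>2)) + 2 * s * 2 ^ card J"
    by (rule cut_and_paste) (use F s nn total in \<open>auto simp: G_def\<close>)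
  finally show ?thesis
    unfolding E_def J_def[symmetric] T1 T2 T3 T4 cJ .
qed

text \<open>The sets \<open>insert i d\<close> and \<open>d\<close> with \<open>i \<notin> d\<close>
  run through all subsets of \<open>I\<close>, so the sums can be exchanged: for each
  \<open>d\<close> there is a single function on the cube, and its Hellinger distances are small for
  all coordinates together.\<close>

lemma disjointness_deterministic:
  fixes s :: real and \<tau> :: "'a set \<Rightarrow> 'a set \<Rightarrow> 't"
  assumes I: "finite I" and F: "finite F" and s: "s > 0"
    and \<tau>: "\<And>x y. x \<subseteq> I \<Longrightarrow> y \<subseteq> I \<Longrightarrow> \<tau> x y \<in> F"
    and rect: "\<And>x y x' y'. x \<subseteq> I \<Longrightarrow> y \<subseteq> I \<Longrightarrow> x' \<subseteq> I \<Longrightarrow> y' \<subseteq> I \<Longrightarrow> \<tau> x y = \<tau> x' y' \<Longrightarrow> \<tau> x y' = \<tau> x y"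
  shows "(\<Sum>i\<in>I. \<Sum>d\<in>Pow (I - {i}). \<Sum>z\<in>Pow (I - {i}). of_bool (g (\<tau> (z \<inter> d) (z - d)))
            - of_bool (g (\<tau> (insert i (z \<inter> d)) (insert i (z - d)))))
        \<le> 4 ^ card I * (4 * ln (card F)) / s + 2 * s * card I * 4 ^ (card I - 1)"
proof -
  define E where "E = (\<lambda>i d. \<Sum>t\<in>F. (sqrt (\<Sum>z\<in>Pow (I - {i}). of_bool (\<tau> (z \<inter> d) (z - d) = t))
      - sqrt (\<Sum>z\<in>Pow (I - {i}). of_bool (\<tau> (insert i z \<inter> d) (insert i z - d) = t)))\<^sup>2)"
  have four: "(2::real) ^ n * 2 ^ n = 4 ^ n" for n
    by (simp add: power_mult_distrib[symmetric])
  have "(\<Sum>i\<in>I. \<Sum>d\<in>Pow (I - {i}). \<Sum>z\<in>Pow (I - {i}). of_bool (g (\<tau> (z \<inter> d) (z - d)))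
            - of_bool (g (\<tau> (insert i (z \<inter> d)) (insert i (z - d)))))
      \<le> (\<Sum>i\<in>I. \<Sum>d\<in>Pow (I - {i}). (1 / s) * (E i (insert i d) + E i d) + 2 * s * 2 ^ (card I - 1))"
    unfolding E_def
    by (intro sum_mono disjointness_single_coordinate, rule I, assumption, erule PowD, rule F, rule s)
      (erule (1) \<tau>, erule (4) rect)
  also have "\<dots> = (\<Sum>i\<in>I. (1 / s) * (\<Sum>d\<in>Pow I. E i d) + 2 * s * 4 ^ (card I - 1))"
  proof (rule sum.cong)
    fix i assume i: "i \<in> I"
    have "(\<Sum>d\<in>Pow (I - {i}). (1 / s) * (E i (insert i d) + E i d) + 2 * s * 2 ^ (card I - 1))
        = (1 / s) * (\<Sum>d\<in>Pow (I - {i}). E i d + E i (insert i d))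
          + 2 ^ (card I - 1) * (2 * s * 2 ^ (card I - 1))"
      using I i by (simp add: sum.distrib sum_divide_distrib[symmetric] card_Pow add_ac)
    also have "\<dots> = (1 / s) * (\<Sum>d\<in>Pow I. E i d) + 2 * s * 4 ^ (card I - 1)"
      unfolding sum_Pow_insert_split[OF I i] using four[of "card I - 1"] by (simp add: mult_ac)
    finally show "(\<Sum>d\<in>Pow (I - {i}). (1 / s) * (E i (insert i d) + E i d) + 2 * s * 2 ^ (card I - 1))
        = (1 / s) * (\<Sum>d\<in>Pow I. E i d) + 2 * s * 4 ^ (card I - 1)" .
  qed simp
  also have "\<dots> = (1 / s) * (\<Sum>d\<in>Pow I. \<Sum>i\<in>I. E i d) + 2 * s * card I * 4 ^ (card I - 1)"
    by (simp add: sum.distrib sum_distrib_left[symmetric] sum_divide_distrib[symmetric]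
        sum.swap[of _ I "Pow I"])
  also have "\<dots> \<le> (1 / s) * (\<Sum>d\<in>Pow I. 2 ^ card I * (4 * ln (card F))) + 2 * s * card I * 4 ^ (card I - 1)"
    unfolding E_def
    by (intro add_right_mono mult_left_mono sum_mono sum_hellinger_coordinates_le)
      (use s F I in \<open>auto intro!: \<tau>\<close>)
  also have "\<dots> = 4 ^ card I * (4 * ln (card F)) / s + 2 * s * card I * 4 ^ (card I - 1)"
    using I four[of "card I"] by (simp add: card_Pow mult.assoc[symmetric])
  finally show ?thesis .
qed

text \<open>The coins are public here, and the dependence of the transcript on them is arbitrary: only
  the events \<open>S x y\<close> have to be measurable.\<close>

theorem (in prob_space) randomized_disjointness:
  fixes \<epsilon> :: real and \<tau> :: "'a \<Rightarrow> 'b set \<Rightarrow> 'b set \<Rightarrow> 't"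
  assumes I: "finite I" and F: "finite F" and \<epsilon>: "\<epsilon> < 1 / 2"
    and \<tau>: "\<And>\<omega> x y. \<omega> \<in> space M \<Longrightarrow> x \<subseteq> I \<Longrightarrow> y \<subseteq> I \<Longrightarrow> \<tau> \<omega> x y \<in> F"
    and rect: "\<And>\<omega> x y x' y'. \<omega> \<in> space M \<Longrightarrow> x \<subseteq> I \<Longrightarrow> y \<subseteq> I \<Longrightarrow> x' \<subseteq> I \<Longrightarrow> y' \<subseteq> I \<Longrightarrow>
        \<tau> \<omega> x y = \<tau> \<omega> x' y' \<Longrightarrow> \<tau> \<omega> x y' = \<tau> \<omega> x y"
    and S: "\<And>x y. x \<subseteq> I \<Longrightarrow> y \<subseteq> I \<Longrightarrow> S x y \<in> events"
    and prob: "\<And>x y. x \<subseteq> I \<Longrightarrow> y \<subseteq> I \<Longrightarrow> prob (S x y) \<ge> 1 - \<epsilon>"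
    and correct: "\<And>\<omega> x y. x \<subseteq> I \<Longrightarrow> y \<subseteq> I \<Longrightarrow> \<omega> \<in> S x y \<Longrightarrow> g (\<tau> \<omega> x y) \<longleftrightarrow> x \<inter> y = {}"
  shows "card I * (1 - 2 * \<epsilon>)\<^sup>2 \<le> 128 * ln (card F)"
proof (cases "card I = 0")
  case True
  obtain \<omega> where "\<omega> \<in> space M" using not_empty by blast
  then have "F \<noteq> {}" using \<tau>[of \<omega> "{}" "{}"] by auto
  then have "card F \<ge> 1" using F by (simp add: Suc_leI card_gt_0_iff)
  then show ?thesis using True by simp
next
  case False
  \<comment> \<open>With this \<open>s\<close> the term \<open>2 * s * m * 4 ^ (m - 1)\<close> is
    half of the advantage \<open>m * 4 ^ (m - 1) * \<delta>\<close> found below and can be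
    absorbed.\<close>
  define \<delta> s where "\<delta> = 1 - 2 * \<epsilon>" and "s = \<delta> / 4"
  define m where "m = card I"
  have \<delta>: "\<delta> > 0" "s > 0" using \<epsilon> by (auto simp: \<delta>_def s_def)
  define Bd where "Bd = 4 ^ m * (4 * ln (card F)) / s + 2 * s * m * 4 ^ (m - 1)"
  define P Q where "P = (\<lambda>d z. S (z \<inter> d) (z - d))"
    and "Q = (\<lambda>(i::'b) d z. S (insert i (z \<inter> d)) (insert i (z - d)))"
  have PQ: "P d z \<in> events" "Q i d z \<in> events" "prob (P d z) \<ge> 1 - \<epsilon>" "prob (Q i d z) \<ge> 1 - \<epsilon>"
    if "i \<in> I" "d \<in> Pow (I - {i})" "z \<in> Pow (I - {i})" for i d z
    using that unfolding P_def Q_def by (intro S prob; auto)+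
  \<comment> \<open>The integrand is built from the success events, whose measurability is known;
    transcripts enter only through the pointwise bound \<open>le\<close>.\<close>
  define f where "f = (\<lambda>\<omega>. \<Sum>i\<in>I. \<Sum>d\<in>Pow (I - {i}). \<Sum>z\<in>Pow (I - {i}).
      (indicator (P d z) \<omega> + indicator (Q i d z) \<omega> - 1 :: real))"
  have le: "f \<omega> \<le> Bd" if \<omega>: "\<omega> \<in> space M" for \<omega>
  proof -
    have "f \<omega> \<le> (\<Sum>i\<in>I. \<Sum>d\<in>Pow (I - {i}). \<Sum>z\<in>Pow (I - {i}). of_bool (g (\<tau> \<omega> (z \<inter> d) (z - d)))
            - of_bool (g (\<tau> \<omega> (insert i (z \<inter> d)) (insert i (z - d)))))"
      unfolding f_def
    proof (intro sum_mono)
      fix i d z assume *: "i \<in> I" "d \<in> Pow (I - {i})" "z \<in> Pow (I - {i})"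
      have "\<omega> \<in> P d z \<Longrightarrow> g (\<tau> \<omega> (z \<inter> d) (z - d))"
        using correct[of "z \<inter> d" "z - d" \<omega>] * by (auto simp: P_def)
      moreover have "\<omega> \<in> Q i d z \<Longrightarrow> \<not> g (\<tau> \<omega> (insert i (z \<inter> d)) (insert i (z - d)))"
        using correct[of "insert i (z \<inter> d)" "insert i (z - d)" \<omega>] * by (auto simp: Q_def)
      ultimately show "indicator (P d z) \<omega> + indicator (Q i d z) \<omega> - 1
          \<le> (of_bool (g (\<tau> \<omega> (z \<inter> d) (z - d)))
            - of_bool (g (\<tau> \<omega> (insert i (z \<inter> d)) (insert i (z - d)))) :: real)"
        by (auto simp: indicator_def)
    qed
    also have "\<dots> \<le> Bd"
      unfolding Bd_def m_def
      by (rule disjointness_deterministic[where \<tau> = "\<tau> \<omega>" and g = g, OF I F \<delta>(2)])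
        (erule (1) \<tau>[OF \<omega>], erule (4) rect[OF \<omega>])
    finally show ?thesis .
  qed
  have "has_bochner_integral M f
      (\<Sum>i\<in>I. \<Sum>d\<in>Pow (I - {i}). \<Sum>z\<in>Pow (I - {i}). prob (P d z) + prob (Q i d z) - 1)"
    unfolding f_def
  proof (intro has_bochner_integral_sum)
    fix i d z assume "i \<in> I" "d \<in> Pow (I - {i})" "z \<in> Pow (I - {i})"
    note * = PQ(1,2)[OF this]
    have "has_bochner_integral M (\<lambda>\<omega>. 1 :: real) 1"
      using prob_space by (simp add: has_bochner_integral_iff)
    then show "has_bochner_integral M (\<lambda>\<omega>. indicator (P d z) \<omega> + indicator (Q i d z) \<omega> - 1 :: real)
        (prob (P d z) + prob (Q i d z) - 1)"
      using * by (intro has_bochner_integral_diff has_bochner_integral_add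
          has_bochner_integral_real_indicator) (auto simp: emeasure_eq_measure)
  qed
  note int = integrable.intros[OF this] has_bochner_integral_integral_eq[OF this]
  have "m * 4 ^ (m - 1) * \<delta> = (\<Sum>i\<in>I. \<Sum>d\<in>Pow (I - {i}). \<Sum>z\<in>Pow (I - {i}). \<delta>)"
  proof -
    have "(\<Sum>i\<in>I. \<Sum>d\<in>Pow (I - {i}). \<Sum>z\<in>Pow (I - {i}). \<delta>) = (\<Sum>i\<in>I. 4 ^ (m - 1) * \<delta>)"
      using I by (intro sum.cong) (auto simp: card_Pow m_def mult.assoc[symmetric] power_mult_distrib[symmetric])
    then show ?thesis by (simp add: m_def)
  qed
  also have "\<dots> \<le> (\<Sum>i\<in>I. \<Sum>d\<in>Pow (I - {i}). \<Sum>z\<in>Pow (I - {i}). prob (P d z) + prob (Q i d z) - 1)"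
  proof (intro sum_mono)
    fix i d z assume "i \<in> I" "d \<in> Pow (I - {i})" "z \<in> Pow (I - {i})"
    from PQ(3,4)[OF this] show "\<delta> \<le> prob (P d z) + prob (Q i d z) - 1" by (simp add: \<delta>_def)
  qed
  also have "\<dots> = (\<integral>\<omega>. f \<omega> \<partial>M)" by (simp add: int(2))
  also have "\<dots> \<le> (\<integral>\<omega>. Bd \<partial>M)" using int(1) le by (intro integral_mono) auto
  also have "\<dots> = Bd" by (simp add: prob_space)
  finally have fin: "m * 4 ^ (m - 1) * \<delta> \<le> Bd" .
  obtain l where l: "m = Suc l" using False by (cases m) (auto simp: m_def)
  define q :: real where "q = 4 ^ l"
  have "q > 0" by (simp add: q_def)
  have "Bd = q * (64 * ln (card F) / \<delta> + m * \<delta> / 2)"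
    unfolding Bd_def s_def q_def using \<delta>(1) by (simp add: l divide_simps) (simp add: algebra_simps)
  moreover have "m * 4 ^ (m - 1) * \<delta> = q * (m * \<delta>)" by (simp add: l q_def algebra_simps)
  ultimately have "q * (m * \<delta>) \<le> q * (64 * ln (card F) / \<delta> + m * \<delta> / 2)"
    using fin by linarith
  with \<open>q > 0\<close> have "m * \<delta> \<le> 64 * ln (card F) / \<delta> + m * \<delta> / 2" by simp
  then have "m * \<delta> / 2 * \<delta> \<le> 64 * ln (card F)" using \<delta> by (simp add: field_simps)
  then show ?thesis by (simp add: m_def \<delta>_def power2_eq_square)
qed

section \<open>Moving cuts\<close>

text \<open>After \<open>t\<close> rounds the vertices in \<open>P t\<close> cannot yet tell the hybrid input \<open>I\<^sub>3\<close> from \<open>I\<^sub>1\<close>, and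
  those in \<open>Q t\<close> cannot tell it from \<open>I\<^sub>2\<close>, because whatever enters \<open>P\<close> or \<open>Q\<close> from outside is
  the same under \<open>I\<^sub>1\<close> and \<open>I\<^sub>2\<close>.\<close>

lemma run_hybrid:
  fixes I\<^sub>1 I\<^sub>2 I\<^sub>3 :: "nat \<Rightarrow> tap_input"
  assumes nbrs: "\<And>v. nbrs (I\<^sub>1 v) = N v" "\<And>v. nbrs (I\<^sub>2 v) = N v" "\<And>v. nbrs (I\<^sub>3 v) = N v"
    and init: "\<And>v. v \<in> P 0 \<Longrightarrow> I\<^sub>3 v = I\<^sub>1 v" "\<And>v. v \<in> Q 0 \<Longrightarrow> I\<^sub>3 v = I\<^sub>2 v"
    and dec: "\<And>t. P (Suc t) \<subseteq> P t" "\<And>t. Q (Suc t) \<subseteq> Q t"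
    and cover: "\<And>t u v. t < R \<Longrightarrow> u \<in> N v \<Longrightarrow> u \<in> P t \<union> Q t"
    and same: "\<And>t u v. t < R \<Longrightarrow> u \<in> N v \<Longrightarrow>
        v \<in> P (Suc t) \<and> u \<notin> P t \<or> v \<in> Q (Suc t) \<and> u \<notin> Q t \<Longrightarrow>
        send A (I\<^sub>1 u) (\<rho> u) (run A I\<^sub>1 \<rho> t u) v = send A (I\<^sub>2 u) (\<rho> u) (run A I\<^sub>2 \<rho> t u) v"
  shows "t \<le> R \<Longrightarrow> (v \<in> P t \<longrightarrow> run A I\<^sub>3 \<rho> t v = run A I\<^sub>1 \<rho> t v) \<and>
      (v \<in> Q t \<longrightarrow> run A I\<^sub>3 \<rho> t v = run A I\<^sub>2 \<rho> t v)"
proof (induction t arbitrary: v)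
  case (Suc t)
  have t: "t < R" "t \<le> R" using Suc.prems by simp_all
  have IH: "v \<in> P t \<Longrightarrow> run A I\<^sub>3 \<rho> t v = run A I\<^sub>1 \<rho> t v"
    "v \<in> Q t \<Longrightarrow> run A I\<^sub>3 \<rho> t v = run A I\<^sub>2 \<rho> t v" for v
    using Suc.IH[OF t(2), of v] by blast+
  have P: "u \<in> P t \<Longrightarrow> u \<in> P 0" and Q: "u \<in> Q t \<Longrightarrow> u \<in> Q 0" for u
    using lift_Suc_antimono_le[of P, OF dec(1), of 0 t] lift_Suc_antimono_le[of Q, OF dec(2), of 0 t]
    by auto
  have msg: "send A (I\<^sub>3 u) (\<rho> u) (run A I\<^sub>3 \<rho> t u) v = send A (I\<^sub>1 u) (\<rho> u) (run A I\<^sub>1 \<rho> t u) v"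
    if "v \<in> P (Suc t)" "u \<in> N v" for u
  proof (cases "u \<in> P t")
    case True
    then show ?thesis using IH(1) init(1) P by simp
  next
    case False
    then have "u \<in> Q t" using cover[OF t(1) that(2)] by simp
    then show ?thesis using IH(2) init(2) Q same[OF t(1) that(2)] that False by simp
  qed
  have msg': "send A (I\<^sub>3 u) (\<rho> u) (run A I\<^sub>3 \<rho> t u) v = send A (I\<^sub>2 u) (\<rho> u) (run A I\<^sub>2 \<rho> t u) v"
    if "v \<in> Q (Suc t)" "u \<in> N v" for u
  proof (cases "u \<in> Q t")
    case True
    then show ?thesis using IH(2) init(2) Q by simp
  next
    case False
    then have "u \<in> P t" using cover[OF t(1) that(2)] by simp
    then show ?thesis using IH(1) init(1) P same[OF t(1) that(2)] that False by simp
  qed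
  have "run A I\<^sub>3 \<rho> (Suc t) v = run A I\<^sub>1 \<rho> (Suc t) v" if "v \<in> P (Suc t)"
    using IH(1)[of v] dec(1)[of t] that msg[OF that] by (auto simp: nbrs fun_eq_iff)
  moreover have "run A I\<^sub>3 \<rho> (Suc t) v = run A I\<^sub>2 \<rho> (Suc t) v" if "v \<in> Q (Suc t)"
    using IH(2)[of v] dec(2)[of t] that msg'[OF that] by (auto simp: nbrs fun_eq_iff)
  ultimately show ?case by blast
qed (use init in simp)

lemma tap_opt_eq_0:
  assumes "finite E" "augmentation V E T Aug" "\<And>e. e \<in> Aug \<Longrightarrow> w e = 0" "\<And>e. e \<in> E \<Longrightarrow> w e \<ge> 0"
  shows "tap_opt V E T w = 0"
proof -
  have "{Aug. augmentation V E T Aug} \<subseteq> Pow E" by (auto simp: augmentation_def)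
  then have "finite {Aug. augmentation V E T Aug}" using assms(1) finite_subset by blast
  moreover have "0 \<in> sum w ` {Aug. augmentation V E T Aug}"
    by (rule image_eqI[of _ _ Aug]) (use assms(2,3) in auto)
  moreover have "0 \<le> a" if "a \<in> sum w ` {Aug. augmentation V E T Aug}" for a
    using that assms(4) by (auto simp: augmentation_def intro!: sum_nonneg)
  ultimately show ?thesis unfolding tap_opt_def by (intro Min_eqI) auto
qed

lemma prob_space_randomness: "prob_space (randomness V)"
  unfolding randomness_def coin_space_def
  by (intro prob_space_PiM prob_space_measure_pmf)

text \<open>Shorter messages are allowed too, which costs one bit over fixed length; hence
  \<open>B + 1\<close> in the bounds below.\<close>

lemma card_bounded_messages: "card {m :: message. length m \<le> B} \<le> 2 ^ (B + 1)"
  and finite_bounded_messages: "finite {m :: message. length m \<le> B}"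
proof -
  have e: "{m :: message. length m \<le> B} = {m. set m \<subseteq> UNIV \<and> length m \<le> B}" by simp
  have "(\<Sum>i\<le>B. 2 ^ i) \<le> (2 ^ (B + 1) :: nat)"
    by (induction B) auto
  then show "card {m :: message. length m \<le> B} \<le> 2 ^ (B + 1)"
    unfolding e by (subst card_lists_length_le) auto
  show "finite {m :: message. length m \<le> B}"
    unfolding e by (rule finite_lists_length_le) simp
qed

text \<open>\<open>P t\<close> and \<open>Q t\<close> are the vertices that have not heard of \<open>y\<close>, respectively \<open>x\<close>, except
  through the messages crossing the boundary.\<close>

theorem moving_cut_lower_bound:
  fixes w :: "'b set \<Rightarrow> 'b set \<Rightarrow> edge \<Rightarrow> real" and \<epsilon> :: real
  assumes I: "finite I" and \<epsilon>: "\<epsilon> < 1 / 2" and W: "W \<ge> 1" and A: "bandwidth B A"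
    and G: "simple_graph V E"
    and approx: "approximates_in_rounds V E T r W a \<epsilon> A R"
    and dec: "\<And>t. P (Suc t) \<subseteq> P t" "\<And>t. Q (Suc t) \<subseteq> Q t"
    and cover: "\<And>t. t \<le> R \<Longrightarrow> V \<subseteq> P t \<union> Q t"
    and bd: "\<And>t. t < R \<Longrightarrow> card {(u, v). {u, v} \<in> E \<and>
        (v \<in> P (Suc t) \<and> u \<notin> P t \<or> v \<in> Q (Suc t) \<and> u \<notin> Q t)} \<le> q"
    and w01: "\<And>x y e. w x y e = 0 \<or> w x y e = 1"
    and wP: "\<And>x y y' v e. v \<in> P 0 \<Longrightarrow> v \<in> e \<Longrightarrow> e \<in> E \<Longrightarrow> w x y e = w x y' e"
    and wQ: "\<And>x x' y v e. v \<in> Q 0 \<Longrightarrow> v \<in> e \<Longrightarrow> e \<in> E \<Longrightarrow> w x y e = w x' y e"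
    and disj: "\<And>x y. x \<subseteq> I \<Longrightarrow> y \<subseteq> I \<Longrightarrow> x \<inter> y = {} \<Longrightarrow> augmentation V E T {e \<in> E. w x y e = 0}"
    and meet: "\<And>x y Aug. x \<subseteq> I \<Longrightarrow> y \<subseteq> I \<Longrightarrow> x \<inter> y \<noteq> {} \<Longrightarrow> augmentation V E T Aug \<Longrightarrow>
        \<exists>e\<in>Aug. w x y e \<noteq> 0"
  shows "card I * (1 - 2 * \<epsilon>)\<^sup>2 \<le> 128 * ((real q * R * (B + 1) + 2) * ln 2)"
proof -
  interpret prob_space "randomness V" by (rule prob_space_randomness)
  have fV: "finite V" and EV: "\<And>e. e \<in> E \<Longrightarrow> e \<subseteq> V \<and> card e = 2"
    using G by (auto simp: simple_graph_def)
  have fE: "finite E" using fV EV by (intro finite_subset[of E "Pow V"]) auto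
  define inp where "inp = (\<lambda>x y. local_input V E T r (w x y))"
  define X where "X = (\<lambda>t. {(u, v). {u, v} \<in> E \<and>
        (v \<in> P (Suc t) \<and> u \<notin> P t \<or> v \<in> Q (Suc t) \<and> u \<notin> Q t)})"
  define msg where "msg = (\<lambda>\<rho> x y t u v. send A (inp x y u) (\<rho> u) (run A (inp x y) \<rho> t u) v)"
  define light where "light = (\<lambda>\<rho> x y v.
      \<forall>u\<in>output_after A (inp x y) \<rho> R v. nbr_weight (inp x y v) u = 0)"
  \<comment> \<open>Besides the messages crossing the boundary, each side contributes one bit:
    whether its vertices chose only edges of weight 0. \<open>P R\<close> and \<open>Q R\<close>
    cover \<open>V\<close>, so both bits together tell whether the output has weight 0.\<close>
  define \<tau> where "\<tau> = (\<lambda>\<rho> x y. ((\<lambda>t\<in>{..<R}. \<lambda>(u, v)\<in>X t. msg \<rho> x y t u v),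
      (\<forall>v\<in>V \<inter> P R. light \<rho> x y v), (\<forall>v\<in>V \<inter> Q R. light \<rho> x y v)))"
  define Msg where "Msg = {m :: message. length m \<le> B}"
  define F where "F = (PiE {..<R} (\<lambda>t. PiE (X t) (\<lambda>_. Msg))) \<times> (UNIV :: bool set) \<times> (UNIV :: bool set)"
  define S where "S = (\<lambda>x y. {\<rho> \<in> space (randomness V).
      approx_output V E T (w x y) a (output_after A (inp x y) \<rho> R)})"
  have nbrs: "nbrs (inp x y v) = {u. {u, v} \<in> E}" for x y v
    by (simp add: inp_def local_input_def)
  have inpP: "inp x y v = inp x y' v" if "v \<in> P 0" for x y y' v
    using wP[OF that] by (auto simp: inp_def local_input_def fun_eq_iff)
  have inpQ: "inp x y v = inp x' y v" if "v \<in> Q 0" for x x' y v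
    using wQ[OF that] by (auto simp: inp_def local_input_def fun_eq_iff)
  have fX: "finite (X t)" for t
    using fV EV by (intro finite_subset[of "X t" "V \<times> V"]) (auto simp: X_def)
  have msgM: "msg \<rho> x y t u v \<in> Msg" for \<rho> x y t u v
    using A by (simp add: msg_def Msg_def bandwidth_def)
  have \<tau>F: "\<tau> \<rho> x y \<in> F" for \<rho> x y
    using msgM by (auto simp: \<tau>_def F_def)
  have fM: "finite Msg" unfolding Msg_def by (rule finite_bounded_messages)
  have fF: "finite F" unfolding F_def using fX fM by (intro finite_cartesian_product finite_PiE) auto
  \<comment> \<open>The hybrid input \<open>x\<close>, \<open>y'\<close> looks like
    \<open>x\<close>, \<open>y\<close> from \<open>P\<close> and like \<open>x'\<close>,
    \<open>y'\<close> from \<open>Q\<close>.\<close>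
  have rect: "\<tau> \<rho> x y' = \<tau> \<rho> x y" if eq: "\<tau> \<rho> x y = \<tau> \<rho> x' y'" for \<rho> x y x' y'
  proof -
    have eqmsg: "msg \<rho> x y t u v = msg \<rho> x' y' t u v" if "t < R" "(u, v) \<in> X t" for t u v
    proof -
      have "fst (\<tau> \<rho> x y) t (u, v) = fst (\<tau> \<rho> x' y') t (u, v)" using eq by simp
      then show ?thesis using that by (simp add: \<tau>_def)
    qed
    have hyb: "(v \<in> P t \<longrightarrow> run A (inp x y') \<rho> t v = run A (inp x y) \<rho> t v) \<and>
        (v \<in> Q t \<longrightarrow> run A (inp x y') \<rho> t v = run A (inp x' y') \<rho> t v)" if "t \<le> R" for t v
    proof (rule run_hybrid[where N = "\<lambda>v. {u. {u, v} \<in> E}" and P = P and Q = Q, OF nbrs nbrs nbrs _ _ dec])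
      show "u \<in> P t \<union> Q t" if "t < R" "u \<in> {u. {u, v} \<in> E}" for t u v
        using that cover[of t] EV[of "{u, v}"] by auto
      show "send A (inp x y u) (\<rho> u) (run A (inp x y) \<rho> t u) v =
          send A (inp x' y' u) (\<rho> u) (run A (inp x' y') \<rho> t u) v"
        if "t < R" "u \<in> {u. {u, v} \<in> E}"
          "v \<in> P (Suc t) \<and> u \<notin> P t \<or> v \<in> Q (Suc t) \<and> u \<notin> Q t" for t u v
        using eqmsg[of t u v] that by (simp add: msg_def X_def)
    qed (use inpP inpQ that in auto)
    have P0: "P t \<subseteq> P 0" "Q t \<subseteq> Q 0" for t
      using lift_Suc_antimono_le[of P, OF dec(1), of 0 t] lift_Suc_antimono_le[of Q, OF dec(2), of 0 t]
      by auto
    have "msg \<rho> x y' t u v = msg \<rho> x y t u v" if t: "t < R" and X: "(u, v) \<in> X t" for t u v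
    proof -
      have "u \<in> P t \<or> u \<in> Q t" using X cover[of t] t EV[of "{u, v}"] by (auto simp: X_def)
      then show ?thesis
      proof
        assume "u \<in> P t"
        then show ?thesis
          using hyb[of t u] t P0[of t] inpP[of u x y' y] by (auto simp: msg_def)
      next
        assume "u \<in> Q t"
        then have "msg \<rho> x y' t u v = msg \<rho> x' y' t u v"
          using hyb[of t u] t P0[of t] inpQ[of u x y' x'] by (auto simp: msg_def)
        then show ?thesis using eqmsg[OF t X] by simp
      qed
    qed
    then have 1: "(\<lambda>t\<in>{..<R}. \<lambda>(u, v)\<in>X t. msg \<rho> x y' t u v)
        = (\<lambda>t\<in>{..<R}. \<lambda>(u, v)\<in>X t. msg \<rho> x y t u v)"
      by (intro restrict_ext) auto
    have 2: "light \<rho> x y' v = light \<rho> x y v" if "v \<in> P R" for v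
      using hyb[of R v] that P0[of R] inpP[of v x y' y]
      by (auto simp: light_def output_after_def)
    have 3: "light \<rho> x y' v = light \<rho> x' y' v" if "v \<in> Q R" for v
      using hyb[of R v] that P0[of R] inpQ[of v x y' x']
      by (auto simp: light_def output_after_def)
    have "(\<forall>v\<in>V \<inter> Q R. light \<rho> x y v) = (\<forall>v\<in>V \<inter> Q R. light \<rho> x' y' v)"
      using eq by (simp add: \<tau>_def)
    then show ?thesis using 1 2 3 by (simp add: \<tau>_def)
  qed
  have pr: "prob (S x y) \<ge> 1 - \<epsilon>" for x y
  proof -
    have "\<forall>e\<in>E. w x y e \<in> \<nat> \<and> w x y e \<le> real W"
    proof
      fix e
      show "w x y e \<in> \<nat> \<and> w x y e \<le> real W" using w01[of x y e] W by auto
    qed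
    then show ?thesis
      using approx unfolding approximates_in_rounds_def S_def inp_def by blast
  qed
  have "card I * (1 - 2 * \<epsilon>)\<^sup>2 \<le> 128 * ln (card F)"
  proof (rule randomized_disjointness[where \<tau> = \<tau> and S = S and g = "\<lambda>(_, b, c). b \<and> c"])
    \<comment> \<open>Its measure is positive, and \<open>measure\<close> vanishes on non-measurable
      sets.\<close>
    show "S x y \<in> events" for x y
      using pr[of x y] \<epsilon> measure_notin_sets[of "S x y" "randomness V"] by fastforce
    show "\<tau> \<rho> x y' = \<tau> \<rho> x y" if "\<tau> \<rho> x y = \<tau> \<rho> x' y'" for \<rho> x y x' y' by (rule rect[OF that])
    show "(case \<tau> \<rho> x y of (_, b, c) \<Rightarrow> b \<and> c) \<longleftrightarrow> x \<inter> y = {}"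
      if xy: "x \<subseteq> I" "y \<subseteq> I" and \<rho>: "\<rho> \<in> S x y" for \<rho> x y
    proof -
      obtain Aug where Aug: "augmentation V E T Aug" "sum (w x y) Aug \<le> a * tap_opt V E T (w x y)"
        "\<And>v. v \<in> V \<Longrightarrow> output_after A (inp x y) \<rho> R v = {u. {u, v} \<in> Aug}"
        using \<rho> by (auto simp: S_def approx_output_def)
      have AE: "Aug \<subseteq> E" using Aug by (simp add: augmentation_def)
      have "(case \<tau> \<rho> x y of (_, b, c) \<Rightarrow> b \<and> c) \<longleftrightarrow> (\<forall>v\<in>V. light \<rho> x y v)"
        using cover[of R] by (auto simp: \<tau>_def)
      also have "\<dots> \<longleftrightarrow> (\<forall>v\<in>V. \<forall>u. {u, v} \<in> Aug \<longrightarrow> w x y {u, v} = 0)"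
      proof (rule ball_cong[OF refl])
        fix v assume "v \<in> V"
        have "nbr_weight (inp x y v) u = w x y {u, v}" if "{u, v} \<in> Aug" for u
          using that AE by (auto simp: inp_def local_input_def)
        then show "light \<rho> x y v \<longleftrightarrow> (\<forall>u. {u, v} \<in> Aug \<longrightarrow> w x y {u, v} = 0)"
          by (simp add: light_def Aug(3)[OF \<open>v \<in> V\<close>])
      qed
      also have "\<dots> \<longleftrightarrow> (\<forall>e\<in>Aug. w x y e = 0)"
      proof
        assume *: "\<forall>v\<in>V. \<forall>u. {u, v} \<in> Aug \<longrightarrow> w x y {u, v} = 0"
        show "\<forall>e\<in>Aug. w x y e = 0"
        proof
          fix e assume e: "e \<in> Aug"
          then obtain u v where "e = {u, v}" using AE EV by (metis card_2_iff subsetD)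
          then show "w x y e = 0" using * e AE EV[of e] by auto
        qed
      qed auto
      also have "\<dots> \<longleftrightarrow> x \<inter> y = {}"
      proof
        assume "\<forall>e\<in>Aug. w x y e = 0"
        then show "x \<inter> y = {}" using meet[OF xy _ Aug(1)] by blast
      next
        assume "x \<inter> y = {}"
        then have "tap_opt V E T (w x y) = 0"
          using w01 by (intro tap_opt_eq_0[OF fE disj[OF xy]]) (auto, metis order_refl zero_le_one)
        then have "sum (w x y) Aug \<le> 0" using Aug(2) by simp
        moreover have nn: "w x y e \<ge> 0" for e using w01[of x y e] by auto
        moreover have "finite Aug" using AE fE finite_subset by blast
        ultimately show "\<forall>e\<in>Aug. w x y e = 0"
          by (metis order_antisym sum_nonneg sum_nonneg_eq_0_iff)
      qed
      finally show ?thesis .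
    qed
  qed (use I fF \<epsilon> \<tau>F pr in auto)
  also have "ln (real (card F)) \<le> (real q * R * (B + 1) + 2) * ln 2"
  proof -
    have M0: "card Msg \<ge> 1" using fM by (auto simp: Msg_def card_gt_0_iff Suc_le_eq intro: exI[of _ "[]"])
    have "card F = (\<Prod>t<R. card Msg ^ card (X t)) * 4"
      by (simp add: F_def card_cartesian_product card_PiE fX)
    also have "\<dots> \<le> (\<Prod>t<R. (2 ^ (B + 1)) ^ q) * 4"
    proof (intro mult_right_mono prod_mono conjI)
      fix t assume "t \<in> {..<R}"
      then have "card (X t) \<le> q" using bd[of t] by (simp add: X_def)
      then have "card Msg ^ card (X t) \<le> card Msg ^ q" using M0 by (intro power_increasing) auto
      also have "\<dots> \<le> (2 ^ (B + 1)) ^ q"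
        using card_bounded_messages[of B] by (intro power_mono) (auto simp: Msg_def)
      finally show "card Msg ^ card (X t) \<le> (2 ^ (B + 1)) ^ q" .
    qed auto
    also have "\<dots> = 2 ^ (q * R * (B + 1) + 2)"
      by (simp add: power_mult[symmetric] power_mult_distrib power_add algebra_simps)
    finally have "real (card F) \<le> 2 ^ (q * R * (B + 1) + 2)"
      by (metis of_nat_le_iff of_nat_numeral of_nat_power)
    moreover have "card F > 0" using fF \<tau>F by (auto simp: card_gt_0_iff)
    ultimately have "ln (real (card F)) \<le> ln (2 ^ (q * R * (B + 1) + 2))"
      by (subst ln_le_cancel_iff) auto
    also have "\<dots> = real (q * R * (B + 1) + 2) * ln 2" by (rule ln_realpow)
    finally show ?thesis by (simp add: algebra_simps)
  qed
  finally show ?thesis by (simp add: add.commute)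
qed

section \<open>Walks, bridges and cycles\<close>

definition adj :: "edge set \<Rightarrow> (nat \<times> nat) set" where
  "adj E = {(u, v). {u, v} \<in> E}"

lemma adj_iff: "(u, v) \<in> adj E \<longleftrightarrow> {u, v} \<in> E"
  by (simp add: adj_def)

lemma sym_adj: "sym (adj E)"
  by (auto simp: sym_def adj_def insert_commute)

lemma adj_mono: "E \<subseteq> E' \<Longrightarrow> adj E \<subseteq> adj E'"
  by (auto simp: adj_def)

lemma relpow_sym:
  assumes "sym r" "(a, b) \<in> r ^^ n"
  shows "(b, a) \<in> r ^^ n"
  using assms(2)
proof (induction n arbitrary: b)
  case (Suc n)
  then obtain c where "(a, c) \<in> r ^^ n" "(c, b) \<in> r" by auto
  with Suc.IH assms(1) show ?case by (meson relpow_Suc_I2 symD)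
qed simp

lemma walk_imp_relpow:
  assumes "is_walk V E xs"
  shows "(hd xs, last xs) \<in> adj E ^^ (length xs - 1)"
  using assms
proof (induction xs rule: induct_list012)
  case (3 x y zs)
  then have "is_walk V E (y # zs)" "(x, y) \<in> adj E" by (auto simp: is_walk_def adj_iff)
  then have "(y, last (y # zs)) \<in> adj E ^^ length zs" using 3 by simp
  then have "(x, last (y # zs)) \<in> adj E ^^ Suc (length zs)"
    using \<open>(x, y) \<in> adj E\<close> by (rule relpow_Suc_I2[rotated])
  then show ?case by simp
qed (auto simp: is_walk_def)

lemma relpow_imp_walk:
  assumes "\<Union> E \<subseteq> V" "(u, v) \<in> adj E ^^ n" "u \<in> V"
  shows "\<exists>xs. is_walk V E xs \<and> hd xs = u \<and> last xs = v \<and> length xs = Suc n"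
  using assms(2,3)
proof (induction n arbitrary: u)
  case 0
  then show ?case by (intro exI[of _ "[u]"]) (auto simp: is_walk_def)
next
  case (Suc n)
  then obtain w where w: "(u, w) \<in> adj E" "(w, v) \<in> adj E ^^ n" by (meson relpow_Suc_D2)
  then have "w \<in> V" using assms(1) by (auto simp: adj_iff)
  with Suc w obtain xs where xs: "is_walk V E xs" "hd xs = w" "last xs = v" "length xs = Suc n"
    by blast
  then show ?case using w Suc.prems
    by (intro exI[of _ "u # xs"]) (auto simp: is_walk_def adj_iff successively_Cons)
qed

lemma graph_connected_iff:
  assumes "\<Union> E \<subseteq> V"
  shows "graph_connected V E \<longleftrightarrow> (\<forall>u\<in>V. \<forall>v\<in>V. (u, v) \<in> (adj E)\<^sup>*)"
proof
  assume *: "graph_connected V E"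
  show "\<forall>u\<in>V. \<forall>v\<in>V. (u, v) \<in> (adj E)\<^sup>*"
  proof (intro ballI)
    fix u v assume "u \<in> V" "v \<in> V"
    with * obtain xs where "is_walk V E xs" "hd xs = u" "last xs = v"
      unfolding graph_connected_def by blast
    with walk_imp_relpow[of V E xs] show "(u, v) \<in> (adj E)\<^sup>*" by (auto intro: relpow_imp_rtrancl)
  qed
next
  assume *: "\<forall>u\<in>V. \<forall>v\<in>V. (u, v) \<in> (adj E)\<^sup>*"
  show "graph_connected V E"
    unfolding graph_connected_def
  proof (intro ballI)
    fix u v assume uv: "u \<in> V" "v \<in> V"
    with * obtain n where "(u, v) \<in> adj E ^^ n" by (meson rtrancl_imp_relpow)
    then show "\<exists>xs. is_walk V E xs \<and> hd xs = u \<and> last xs = v"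
      using relpow_imp_walk[OF assms _ uv(1)] by blast
  qed
qed

lemma graph_dist_le:
  assumes "\<Union> E \<subseteq> V" "(u, v) \<in> adj E ^^ n" "u \<in> V"
  shows "graph_dist V E u v \<le> n"
  unfolding graph_dist_def using relpow_imp_walk[OF assms] by (rule Least_le)

text \<open>A potential that rises by at most 1 per edge cannot outrun the distance. Integer values
  allow the two ends to lie on opposite sides of 0.\<close>

lemma graph_dist_ge:
  fixes f :: "nat \<Rightarrow> int"
  assumes "\<Union> E \<subseteq> V" "u \<in> V" "(u, v) \<in> (adj E)\<^sup>*"
    and lip: "\<And>a b. {a, b} \<in> E \<Longrightarrow> f b \<le> f a + 1"
  shows "f v - f u \<le> graph_dist V E u v"
proof -
  obtain n where "(u, v) \<in> adj E ^^ n" using assms(3) by (meson rtrancl_imp_relpow)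
  from relpow_imp_walk[OF assms(1) this assms(2)]
  have "\<exists>l. \<exists>xs. is_walk V E xs \<and> hd xs = u \<and> last xs = v \<and> length xs = Suc l" by blast
  from LeastI_ex[OF this, folded graph_dist_def]
  obtain xs where "is_walk V E xs" "hd xs = u" "last xs = v" "length xs = Suc (graph_dist V E u v)"
    by blast
  then have path: "(u, v) \<in> adj E ^^ graph_dist V E u v" using walk_imp_relpow[of V E xs] by simp
  have "(a, b) \<in> adj E ^^ m \<Longrightarrow> f b \<le> f a + int m" for a b m
  proof (induction m arbitrary: b)
    case (Suc m)
    then obtain c where "(a, c) \<in> adj E ^^ m" "(c, b) \<in> adj E" by auto
    with Suc.IH[of c] lip[of c b] show ?case by (simp add: adj_iff)
  qed simp
  from this[OF path] show ?thesis by simp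
qed

text \<open>The equivalence relation whose classes are the 2-edge-connected components; its
  transitivity lets 2-edge-connectivity be assembled piece by piece. As \<open>e\<close> ranges over
  all sets, not just members of \<open>E\<close>, plain reachability is included.\<close>

definition bridgeless_conn :: "edge set \<Rightarrow> nat \<Rightarrow> nat \<Rightarrow> bool" where
  "bridgeless_conn E u v \<longleftrightarrow> (\<forall>e. (u, v) \<in> (adj (E - {e}))\<^sup>*)"

lemma bridgeless_conn_refl: "bridgeless_conn E u u"
  by (simp add: bridgeless_conn_def)

lemma bridgeless_conn_sym: "bridgeless_conn E u v \<Longrightarrow> bridgeless_conn E v u"
  unfolding bridgeless_conn_def by (meson sym_adj sym_rtrancl symD)

lemma bridgeless_conn_trans:
  "bridgeless_conn E u v \<Longrightarrow> bridgeless_conn E v w \<Longrightarrow> bridgeless_conn E u w"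
  unfolding bridgeless_conn_def by (meson rtrancl_trans)

lemma bridgeless_conn_triangle:
  assumes "{u, v} \<in> E" "{u, w} \<in> E" "{w, v} \<in> E" "w \<noteq> u" "w \<noteq> v"
  shows "bridgeless_conn E u v"
  unfolding bridgeless_conn_def
proof
  fix e
  show "(u, v) \<in> (adj (E - {e}))\<^sup>*"
  proof (cases "e = {u, v}")
    case True
    then have "(u, w) \<in> adj (E - {e})" "(w, v) \<in> adj (E - {e})"
      using assms by (auto simp: adj_iff doubleton_eq_iff)
    then show ?thesis by (meson r_into_rtrancl rtrancl.rtrancl_into_rtrancl)
  next
    case False
    then show ?thesis using assms(1) by (auto simp: adj_iff)
  qed
qed

text \<open>If the first edge is lost, the second offers a detour. Used to attach a path to the tree
  by its tree edge and one free spoke.\<close>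

lemma bridgeless_conn_two_edges:
  assumes "{a, b} \<in> E" "{a', b'} \<in> E" "{a, b} \<noteq> {a', b'}"
    and "bridgeless_conn E a a'" "bridgeless_conn E b b'"
  shows "bridgeless_conn E a b"
  unfolding bridgeless_conn_def
proof
  fix e
  show "(a, b) \<in> (adj (E - {e}))\<^sup>*"
  proof (cases "e = {a, b}")
    case True
    then have "(a', b') \<in> adj (E - {e})" using assms by (auto simp: adj_iff)
    moreover have "(a, a') \<in> (adj (E - {e}))\<^sup>*" "(b', b) \<in> (adj (E - {e}))\<^sup>*"
      using assms(4) bridgeless_conn_sym[OF assms(5)] by (auto simp: bridgeless_conn_def)
    ultimately show ?thesis by (meson rtrancl.rtrancl_into_rtrancl rtrancl_trans)
  next
    case False
    then show ?thesis using assms(1) by (auto simp: adj_iff)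
  qed
qed

lemma two_edge_connectedI:
  assumes "\<Union> E \<subseteq> V" "\<And>v. v \<in> V \<Longrightarrow> bridgeless_conn F r v" "F \<subseteq> E"
  shows "two_edge_connected V E"
proof -
  have *: "graph_connected V (E - {e})" for e
  proof (subst graph_connected_iff)
    show "\<forall>u\<in>V. \<forall>v\<in>V. (u, v) \<in> (adj (E - {e}))\<^sup>*"
    proof (intro ballI)
      fix u v assume "u \<in> V" "v \<in> V"
      then have "bridgeless_conn F u v"
        by (intro bridgeless_conn_trans[OF bridgeless_conn_sym[OF assms(2)] assms(2)])
      moreover have "(adj (F - {e}))\<^sup>* \<subseteq> (adj (E - {e}))\<^sup>*"
        using assms(3) by (intro rtrancl_mono adj_mono) auto
      ultimately show "(u, v) \<in> (adj (E - {e}))\<^sup>*" by (auto simp: bridgeless_conn_def)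
    qed
  qed (use assms in auto)
  moreover have "graph_connected V E"
  proof (subst graph_connected_iff)
    \<comment> \<open>The empty set is never an unordered pair, so this instance is plain
      connectivity.\<close>
    have "(adj (E - {{}}))\<^sup>* \<subseteq> (adj E)\<^sup>*" by (intro rtrancl_mono adj_mono) auto
    then show "\<forall>u\<in>V. \<forall>v\<in>V. (u, v) \<in> (adj E)\<^sup>*"
      using *[of "{}"] graph_connected_iff[of "E - {{}}" V] assms(1) by blast
  qed (use assms in auto)
  ultimately show ?thesis by (simp add: two_edge_connected_def)
qed

text \<open>Both cycle neighbours of the deepest vertex of a cycle would be its parent.\<close>

lemma no_cycle_in_parent_graph:
  fixes depth :: "nat \<Rightarrow> nat"
  assumes "\<And>u v. {u, v} \<in> T \<Longrightarrow> (u = par v \<and> depth u < depth v) \<or> (v = par u \<and> depth v < depth u)"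
  shows "\<not> is_cycle T xs"
proof
  assume c: "is_cycle T xs"
  define n where "n = length xs"
  have n: "n \<ge> 3" and d: "distinct xs" using c by (auto simp: is_cycle_def n_def)
  then have ne: "xs \<noteq> []" by (auto simp: n_def)
  have step: "{xs ! i, xs ! (Suc i mod n)} \<in> T" if "i < n" for i
  proof (cases "Suc i < n")
    case True
    then show ?thesis using c by (auto simp: is_cycle_def n_def successively_conv_nth)
  next
    case False
    then have "Suc i = n" using that by simp
    then have "i = n - 1" "Suc i mod n = 0" by auto
    then show ?thesis using c ne by (auto simp: is_cycle_def n_def last_conv_nth hd_conv_nth)
  qed
  have "Max (depth ` set xs) \<in> depth ` set xs" using ne by (intro Max_in) auto
  then obtain i where i: "i < n" "depth (xs ! i) = Max (depth ` set xs)"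
    by (auto simp: in_set_conv_nth n_def)
  have max: "depth (xs ! j) \<le> depth (xs ! i)" if "j < n" for j
    unfolding i(2) using that by (intro Max_ge) (auto simp: n_def)
  define s p where "s = Suc i mod n" and "p = (if i = 0 then n - 1 else i - 1)"
  have sp: "s < n" "p < n" "Suc p mod n = i" using i n by (auto simp: s_def p_def)
  have "s \<noteq> p"
  proof (cases "Suc i < n")
    case True
    then show ?thesis using n by (auto simp: s_def p_def)
  next
    case False
    then have "i = n - 1" using i by simp
    then show ?thesis using n by (auto simp: s_def p_def)
  qed
  moreover have "xs ! s = par (xs ! i)"
    using assms[OF step[OF i(1)]] max[OF sp(1)] by (auto simp: s_def)
  moreover have "xs ! p = par (xs ! i)"
    using assms[OF step[OF sp(2)]] max[OF sp(2)] sp(3) by auto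
  ultimately show False using d sp by (metis n_def nth_eq_iff_index_eq)
qed

text \<open>Graphs have natural numbers as vertices, while the construction uses pairs of a row and
  a position. The orientation in \<open>S\<close> is forgotten here but keeps case analyses
  short.\<close>

definition edge_graph :: "((nat \<times> nat) \<times> (nat \<times> nat)) set \<Rightarrow> edge set" where
  "edge_graph S = (\<lambda>(a, b). {prod_encode a, prod_encode b}) ` S"

lemma edge_graph_iff:
  "{prod_encode a, prod_encode b} \<in> edge_graph S \<longleftrightarrow> (a, b) \<in> S \<or> (b, a) \<in> S"
proof -
  have inj: "prod_encode x = prod_encode y \<longleftrightarrow> x = y" for x y
    by (simp add: prod_encode_eq)
  show ?thesis by (auto simp: edge_graph_def image_iff doubleton_eq_iff inj)
qed

lemma edge_graphI: "(a, b) \<in> S \<Longrightarrow> {prod_encode a, prod_encode b} \<in> edge_graph S"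
  "(a, b) \<in> S \<Longrightarrow> {prod_encode b, prod_encode a} \<in> edge_graph S"
  by (simp_all add: edge_graph_iff)

section \<open>The lower bound family\<close>

locale tap_family =
  fixes k p m :: nat
  assumes k: "2 \<le> k" and p: "2 \<le> p" and m: "1 \<le> m"
begin

text \<open>Row \<open>i \<le> p\<close> is level \<open>i\<close> of the complete \<open>k\<close>-ary tree, row \<open>p + 1\<close> is a tail hanging off the
  root that only serves to make the diameter exact, and the rows from \<open>p + 2\<close> on are the \<open>m\<close> paths,
  whose \<open>j\<close>-th vertex is joined to the \<open>j\<close>-th leaf.\<close>

definition verts :: "(nat \<times> nat) set" where
  "verts = {(i, j). if i \<le> p then j < k ^ i else if i = p + 1 then j \<le> 2 * p
                    else i < p + 2 + m \<and> j < k ^ p}"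

text \<open>The arcs \<open>sibling\<close> and \<open>skip\<close>, and the second
  \<open>tail\<close> arc, close the other edges into triangles. Siblings are joined only to the
  first child, \<open>j - j mod k\<close>, so that a tree vertex has O(k) arcs below it rather than
  quadratically many.\<close>

inductive_set arcs :: "((nat \<times> nat) \<times> (nat \<times> nat)) set" where
  up: "i < p \<Longrightarrow> j < k ^ Suc i \<Longrightarrow> ((Suc i, j), (i, j div k)) \<in> arcs"
| sibling: "i < p \<Longrightarrow> j < k ^ Suc i \<Longrightarrow> j mod k \<noteq> 0 \<Longrightarrow> ((Suc i, j), (Suc i, j - j mod k)) \<in> arcs"
| step: "p < i \<Longrightarrow> (i, Suc j) \<in> verts \<Longrightarrow> ((i, Suc j), (i, j)) \<in> arcs"
| skip: "p < i \<Longrightarrow> (i, Suc (Suc j)) \<in> verts \<Longrightarrow> ((i, Suc (Suc j)), (i, j)) \<in> arcs"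
| tail: "j \<le> 1 \<Longrightarrow> ((p + 1, j), (0, 0)) \<in> arcs"
| spoke: "p + 2 \<le> i \<Longrightarrow> i < p + 2 + m \<Longrightarrow> j < k ^ p \<Longrightarrow> ((i, j), (p, j)) \<in> arcs"

text \<open>All paths hang on the leaf \<open>(p, 0)\<close>. Truncated subtraction makes the root
  its own parent, hence its exclusion in \<open>T\<close>.\<close>

fun par :: "nat \<times> nat \<Rightarrow> nat \<times> nat" where
  "par (i, j) = (if i \<le> p then (i - 1, j div k)
                 else if j = 0 then (if i = p + 1 then (0, 0) else (p, 0)) else (i, j - 1))"

definition V :: "nat set" where "V = prod_encode ` verts"
definition E :: "edge set" where "E = edge_graph arcs"
definition T :: "edge set" where "T = edge_graph {(v, par v) | v. v \<in> verts \<and> v \<noteq> (0, 0)}"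
definition root :: nat where "root = prod_encode (0, 0)"

text \<open>The first player controls the spokes at position \<open>1\<close>, the second one those at the last
  position; the spoke at position \<open>0\<close> is a tree edge.\<close>

definition heavy :: "nat set \<Rightarrow> nat set \<Rightarrow> ((nat \<times> nat) \<times> (nat \<times> nat)) set" where
  "heavy x y = {((i, j), (p, j)) | i j. p + 2 \<le> i \<and> i < p + 2 + m \<and> 1 \<le> j \<and> j < k ^ p \<and>
      (j = 1 \<longrightarrow> i - (p + 2) \<in> x) \<and> (j = k ^ p - 1 \<longrightarrow> i - (p + 2) \<in> y)}"

definition weight :: "nat set \<Rightarrow> nat set \<Rightarrow> edge \<Rightarrow> real" where
  "weight x y e = (if e \<in> edge_graph (heavy x y) then 1 else 0)"

text \<open>Keeps the positions 0, 1 and \<open>k ^ p - 1\<close> distinct and gives every path a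
  third vertex for its triangles.\<close>

lemma L_ge: "4 \<le> k ^ p"
proof -
  have "(2::nat) ^ 2 \<le> 2 ^ p" using p by (intro power_increasing) auto
  also have "\<dots> \<le> k ^ p" using k by (intro power_mono) auto
  finally show ?thesis by simp
qed

lemma p_less_L: "p + 1 \<le> k ^ p"
proof -
  have "p < 2 ^ p" by (rule less_exp)
  also have "\<dots> \<le> k ^ p" using k by (intro power_mono) auto
  finally show ?thesis by simp
qed

lemma arc_cases [consumes 1, case_names up sibling step skip tail spoke]:
  assumes "(a, b) \<in> arcs"
  obtains i j where "a = (Suc i, j)" "b = (i, j div k)" "i < p" "j < k ^ Suc i"
  | i j where "a = (Suc i, j)" "b = (Suc i, j - j mod k)" "i < p" "j < k ^ Suc i" "j mod k \<noteq> 0"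
  | i j where "a = (i, Suc j)" "b = (i, j)" "p < i" "(i, Suc j) \<in> verts"
  | i j where "a = (i, Suc (Suc j))" "b = (i, j)" "p < i" "(i, Suc (Suc j)) \<in> verts"
  | j where "a = (p + 1, j)" "b = (0, 0)" "j \<le> 1"
  | i j where "a = (i, j)" "b = (p, j)" "p + 2 \<le> i" "i < p + 2 + m" "j < k ^ p"
proof -
  obtain a1 a2 b1 b2 where [simp]: "a = (a1, a2)" "b = (b1, b2)" by (cases a, cases b)
  from assms show thesis by (auto elim!: arcs.cases intro: that)
qed

lemma arcs_in_verts:
  assumes "(a, b) \<in> arcs"
  shows "a \<in> verts \<and> b \<in> verts \<and> a \<noteq> b"
  using assms
proof (cases rule: arc_cases)
  case (up i j)
  have "j div k < k ^ i" using up k by (simp add: less_mult_imp_div_less mult.commute)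
  then show ?thesis using up by (auto simp: verts_def)
next
  case (sibling i j)
  then have "j - j mod k < k ^ Suc i" by simp
  moreover have "j - j mod k < j" using sibling mod_less_eq_dividend[of j k] by linarith
  ultimately show ?thesis using sibling by (auto simp: verts_def)
next
  case (tail j)
  then show ?thesis using p by (auto simp: verts_def)
next
  case (spoke i j)
  then show ?thesis by (auto simp: verts_def)
qed (auto simp: verts_def)

lemma root_in: "(0, 0) \<in> verts" by (simp add: verts_def)

lemma verts_nonroot_cases:
  assumes "v \<in> verts" "v \<noteq> (0, 0)"
  obtains (tree) i j where "v = (Suc i, j)" "i < p" "j < k ^ Suc i" "par v = (i, j div k)"
  | (step) i j where "v = (i, Suc j)" "p < i" "(i, Suc j) \<in> verts" "par v = (i, j)"
  | (tail) "v = (p + 1, 0)" "par v = (0, 0)"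
  | (spoke) i where "v = (i, 0)" "p + 2 \<le> i" "i < p + 2 + m" "par v = (p, 0)"
proof -
  obtain i j where v: "v = (i, j)" by (cases v)
  consider "i \<le> p" "i = 0" | i' where "i \<le> p" "i = Suc i'" | j' where "p < i" "j = Suc j'"
    | "i = p + 1" "j = 0" | "p + 2 \<le> i" "j = 0"
    by (cases i; cases j) force+
  then show thesis
  proof cases
    case 1
    then show ?thesis using assms v by (auto simp: verts_def)
  next
    case (2 i')
    then show ?thesis using assms v by (intro tree[of i' j]) (auto simp: verts_def)
  next
    case (3 j')
    then show ?thesis using assms v by (intro step[of i j']) auto
  next
    case 4
    then show ?thesis using v by (intro tail) auto
  next
    case 5
    then show ?thesis using assms v by (intro spoke[of i]) (auto simp: verts_def)
  qed
qed

lemma par_arc: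
  assumes "v \<in> verts" "v \<noteq> (0, 0)"
  shows "(v, par v) \<in> arcs"
  using assms
proof (cases v rule: verts_nonroot_cases)
  case (tree i j)
  then show ?thesis by (auto intro: arcs.up)
next
  case (step i j)
  then show ?thesis by (auto intro: arcs.step)
next
  case tail
  then show ?thesis using arcs.tail[of 0] by simp
next
  case (spoke i)
  then show ?thesis using arcs.spoke[of i 0] k by simp
qed

section \<open>The spanning tree: depth, size and height\<close>

fun depth :: "nat \<times> nat \<Rightarrow> nat" where
  "depth (i, j) = (if i \<le> p then i else if i = p + 1 then Suc j else p + 1 + j)"

lemma depth_par:
  assumes "v \<in> verts" "v \<noteq> (0, 0)"
  shows "depth v = Suc (depth (par v))"
  using assms
proof (cases v rule: verts_nonroot_cases)
  case (step i j)
  then show ?thesis by auto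
qed auto

lemma T_subset: "T \<subseteq> E"
  using par_arc by (fastforce simp: T_def E_def edge_graph_def)

lemma tree_edgeI: "v \<in> verts \<Longrightarrow> v \<noteq> (0, 0) \<Longrightarrow> {prod_encode v, prod_encode (par v)} \<in> T"
  unfolding T_def by (rule edge_graphI) blast

lemma E_subset: "e \<in> E \<Longrightarrow> e \<subseteq> V \<and> card e = 2"
proof -
  assume "e \<in> E"
  then obtain a b where "(a, b) \<in> arcs" "e = {prod_encode a, prod_encode b}"
    by (auto simp: E_def edge_graph_def)
  with arcs_in_verts[of a b] show ?thesis by (auto simp: V_def prod_encode_eq)
qed

lemma Union_E: "\<Union> E \<subseteq> V" using E_subset by blast
lemma Union_T: "\<Union> T \<subseteq> V" using Union_E T_subset by blast

lemma depth_path: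
  "v \<in> verts \<Longrightarrow> (root, prod_encode v) \<in> adj T ^^ depth v"
proof (induction "depth v" arbitrary: v)
  case 0
  then have "v = (0, 0)" using depth_par[of v] by force
  then show ?case by (simp add: root_def)
next
  case (Suc n)
  then have v: "v \<noteq> (0, 0)" by auto
  then have d: "depth v = Suc (depth (par v))" using depth_par Suc by blast
  then have "(root, prod_encode (par v)) \<in> adj T ^^ depth (par v)"
    using Suc.hyps Suc.prems arcs_in_verts[OF par_arc[OF Suc.prems v]] by auto
  moreover have "(prod_encode (par v), prod_encode v) \<in> adj T"
    using tree_edgeI[OF Suc.prems v] by (simp add: adj_iff insert_commute)
  ultimately show ?case unfolding d by auto
qed

lemma root_V: "root \<in> V" using root_in by (simp add: root_def V_def)

lemma verts_subset:
  "verts \<subseteq> {..p} \<times> {..<k ^ p} \<union> {p + 1} \<times> {..2 * p} \<union> {p + 2..<p + 2 + m} \<times> {..<k ^ p}"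
proof
  fix v assume v: "v \<in> verts"
  obtain i j where ij: "v = (i, j)" by (cases v)
  have "i \<le> p \<Longrightarrow> k ^ i \<le> k ^ p" using k by (intro power_increasing) auto
  then show "v \<in> {..p} \<times> {..<k ^ p} \<union> {p + 1} \<times> {..2 * p} \<union> {p + 2..<p + 2 + m} \<times> {..<k ^ p}"
    using v unfolding ij by (auto simp: verts_def split: if_splits)
qed

lemma finite_verts: "finite verts"
  by (rule finite_subset[OF verts_subset]) auto

lemma finite_V: "finite V" using finite_verts by (simp add: V_def)

lemma card_V:
  "m * k ^ p \<le> card V" "card V \<le> (p + 1) * k ^ p + (2 * p + 1) + m * k ^ p"
proof -
  have c: "card V = card verts"
    unfolding V_def by (intro card_image) (auto simp: inj_on_def prod_encode_eq)
  have "{p + 2..<p + 2 + m} \<times> {..<k ^ p} \<subseteq> verts" by (auto simp: verts_def)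
  then have "card ({p + 2..<p + 2 + m} \<times> {..<k ^ p}) \<le> card verts"
    using finite_verts by (intro card_mono)
  then show "m * k ^ p \<le> card V" by (simp add: c card_cartesian_product)
  have "card verts \<le> card ({..p} \<times> {..<k ^ p} \<union> {p + 1} \<times> {..2 * p} \<union> {p + 2..<p + 2 + m} \<times> {..<k ^ p})"
    by (rule card_mono[OF _ verts_subset]) auto
  also have "\<dots> \<le> card ({..p} \<times> {..<k ^ p}) + card ({p + 1} \<times> {..2 * p})
      + card ({p + 2..<p + 2 + m} \<times> {..<k ^ p})"
    by (meson add_mono card_Un_le le_refl order_trans)
  finally show "card V \<le> (p + 1) * k ^ p + (2 * p + 1) + m * k ^ p"
    by (simp add: c card_cartesian_product)
qed

lemma simple_graph_E: "simple_graph V E"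
  using finite_V E_subset by (simp add: simple_graph_def)

lemma spanning_tree_T: "spanning_tree V E T"
proof -
  have "graph_connected V T"
    unfolding graph_connected_iff[OF Union_T]
  proof (intro ballI)
    have r: "(root, v) \<in> (adj T)\<^sup>*" if "v \<in> V" for v
      using depth_path that by (auto simp: V_def intro: relpow_imp_rtrancl)
    fix u v assume "u \<in> V" "v \<in> V"
    then show "(u, v) \<in> (adj T)\<^sup>*"
      using r sym_rtrancl[OF sym_adj, of T] by (meson rtrancl_trans symD)
  qed
  moreover have "\<not> is_cycle T xs" for xs
  proof (rule no_cycle_in_parent_graph)
    fix u v assume "{u, v} \<in> T"
    then obtain q where q: "q \<in> {(v, par v) | v. v \<in> verts \<and> v \<noteq> (0, 0)}"
      "{u, v} = (\<lambda>(a, b). {prod_encode a, prod_encode b}) q"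
      unfolding T_def edge_graph_def by (rule imageE) (rule that)
    then obtain a where "a \<in> verts" "a \<noteq> (0, 0)" "q = (a, par a)" by blast
    with q have a: "a \<in> verts" "a \<noteq> (0, 0)" "{u, v} = {prod_encode a, prod_encode (par a)}"
      by simp_all
    show "(u = (prod_encode \<circ> par \<circ> prod_decode) v \<and> (depth \<circ> prod_decode) u < (depth \<circ> prod_decode) v) \<or>
        (v = (prod_encode \<circ> par \<circ> prod_decode) u \<and> (depth \<circ> prod_decode) v < (depth \<circ> prod_decode) u)"
      using depth_par[OF a(1,2)] a(3) by (auto simp: doubleton_eq_iff)
  qed
  ultimately show ?thesis using T_subset by (auto simp: spanning_tree_def)
qed

lemma depth_le: "v \<in> verts \<Longrightarrow> depth v \<le> 2 * k ^ p"
  using p_less_L by (cases v) (auto simp: verts_def split: if_splits)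

lemma tree_height_le: "tree_height V T root \<le> 2 * k ^ p"
  unfolding tree_height_def
proof (subst Max_le_iff)
  show "\<forall>d\<in>graph_dist V T root ` V. d \<le> 2 * k ^ p"
  proof
    fix d assume "d \<in> graph_dist V T root ` V"
    then obtain v where v: "v \<in> verts" "d = graph_dist V T root (prod_encode v)"
      by (auto simp: V_def)
    have "d \<le> depth v" unfolding v(2) by (rule graph_dist_le[OF Union_T depth_path[OF v(1)] root_V])
    then show "d \<le> 2 * k ^ p" using depth_le[OF v(1)] by simp
  qed
qed (use finite_V root_V in auto)

section \<open>Short walks from the root, and the diameter\<close>

fun level :: "nat \<times> nat \<Rightarrow> nat" where
  "level (i, j) = (if i \<le> p then i else if i = p + 1 then j div 2 + 1 else p + 1)"

lemma level_le: "v \<in> verts \<Longrightarrow> level v \<le> p + 1"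
  by (cases v) (auto simp: verts_def split: if_splits)

lemma arc_adj: "(a, b) \<in> arcs \<Longrightarrow> (prod_encode b, prod_encode a) \<in> adj E"
  unfolding adj_iff E_def by (rule edge_graphI)

lemma level_path_tree:
  "i \<le> p \<Longrightarrow> j < k ^ i \<Longrightarrow> (root, prod_encode (i, j)) \<in> adj E ^^ i"
proof (induction i arbitrary: j)
  case (Suc i)
  have "j div k < k ^ i" using Suc.prems by (simp add: less_mult_imp_div_less mult.commute)
  then have "(root, prod_encode (i, j div k)) \<in> adj E ^^ i" using Suc by simp
  moreover have "((Suc i, j), (i, j div k)) \<in> arcs" using Suc.prems by (intro arcs.up) auto
  ultimately show ?case using arc_adj by (auto intro: relcompI)
qed (simp add: root_def)

text \<open>Skip arcs halve the length of the tail. Its last position \<open>2 * p\<close> thus has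
  level \<open>p + 1\<close>, the same as the path vertices on the other side of the root.\<close>

lemma level_path_tail:
  "j \<le> 2 * p \<Longrightarrow> (root, prod_encode (p + 1, j)) \<in> adj E ^^ (j div 2 + 1)"
proof (induction j rule: induct_nat_012)
  case (ge2 j)
  then have "(root, prod_encode (p + 1, j)) \<in> adj E ^^ (j div 2 + 1)" by simp
  moreover have "((p + 1, Suc (Suc j)), (p + 1, j)) \<in> arcs"
    using ge2.prems by (intro arcs.skip) (auto simp: verts_def)
  moreover have "Suc (Suc j) div 2 + 1 = Suc (j div 2 + 1)" by simp
  ultimately show ?case using arc_adj by (metis relpow_Suc_I)
qed (use arc_adj[OF arcs.tail] in \<open>auto simp: root_def\<close>)

lemma level_path:
  assumes "v \<in> verts"
  shows "(root, prod_encode v) \<in> adj E ^^ level v"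
proof -
  obtain i j where v: "v = (i, j)" by (cases v)
  consider "i \<le> p" "j < k ^ i" | "i = p + 1" "j \<le> 2 * p" | "p + 2 \<le> i" "i < p + 2 + m" "j < k ^ p"
    using assms v by (fastforce simp: verts_def split: if_splits)
  then show ?thesis
  proof cases
    case 1
    then show ?thesis using level_path_tree v by simp
  next
    case 2
    then show ?thesis using level_path_tail v by simp
  next
    case 3
    have "(root, prod_encode (p, j)) \<in> adj E ^^ p" using 3 by (intro level_path_tree) auto
    then have "(root, prod_encode (i, j)) \<in> adj E ^^ Suc p"
      using arc_adj[OF arcs.spoke[of i j]] 3 by (metis relpow_Suc_I)
    then show ?thesis using 3 v by simp
  qed
qed

text \<open>The diameter is attained across the root, which separates the tail from the rest.\<close>

lemma graph_diameter_eq: "graph_diameter V E = 2 * p + 2"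
  unfolding graph_diameter_def
proof (rule Max_eqI)
  have "{graph_dist V E u v |u v. u \<in> V \<and> v \<in> V} = (\<lambda>(u, v). graph_dist V E u v) ` (V \<times> V)"
    by auto
  then show "finite {graph_dist V E u v |u v. u \<in> V \<and> v \<in> V}" using finite_V by simp
next
  have le: "graph_dist V E u v \<le> 2 * p + 2" if uv: "u \<in> V" "v \<in> V" for u v
  proof -
    obtain a b where ab: "a \<in> verts" "b \<in> verts" "u = prod_encode a" "v = prod_encode b"
      using uv by (auto simp: V_def)
    have "(u, root) \<in> adj E ^^ level a" "(root, v) \<in> adj E ^^ level b"
      using level_path ab relpow_sym[OF sym_adj] by auto
    then have "(u, v) \<in> adj E ^^ (level a + level b)" by (auto simp: relpow_add)
    then have "graph_dist V E u v \<le> level a + level b" using graph_dist_le[OF Union_E _ uv(1)] by blast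
    then show ?thesis using level_le[OF ab(1)] level_le[OF ab(2)] by simp
  qed
  then show "d \<le> 2 * p + 2" if "d \<in> {graph_dist V E u v |u v. u \<in> V \<and> v \<in> V}" for d
    using that by auto
  \<comment> \<open>The level with its sign reversed on the tail, so that the two extreme vertices
    differ by \<open>2 * (p + 1)\<close>.\<close>
  define f where "f = (\<lambda>v. let (i, j) = prod_decode v in
      if i = p + 1 then - int (j div 2 + 1) else int (level (i, j)))"
  have fe: "f (prod_encode (i, j)) = (if i = p + 1 then - int (j div 2 + 1) else int (level (i, j)))" for i j
    by (simp add: f_def)
  have arc: "\<bar>f (prod_encode a) - f (prod_encode b)\<bar> \<le> 1" if "(a, b) \<in> arcs" for a b
    using that
  proof (cases rule: arc_cases)
    case (step i j)
    then show ?thesis by (auto simp: fe)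
  qed (auto simp: fe)
  have lip: "f b \<le> f a + 1" if "{a, b} \<in> E" for a b
    using that arc[of "prod_decode a" "prod_decode b"] arc[of "prod_decode b" "prod_decode a"]
      edge_graph_iff[of "prod_decode a" "prod_decode b" arcs] by (auto simp: E_def)
  define u v where "u = prod_encode (p + 1, 2 * p)" and "v = prod_encode (p + 2, 0)"
  have uv: "u \<in> V" "v \<in> V" using m k by (auto simp: u_def v_def V_def verts_def)
  have "(u, v) \<in> (adj E)\<^sup>*"
    using spanning_tree_T uv rtrancl_mono[OF adj_mono[OF T_subset]]
    by (auto simp: spanning_tree_def graph_connected_iff[OF Union_T])
  from graph_dist_ge[OF Union_E uv(1) this, of f] lip have "f v - f u \<le> graph_dist V E u v" by blast
  then have "2 * p + 2 \<le> graph_dist V E u v" by (simp add: fe u_def v_def)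
  with le[OF uv] have "graph_dist V E u v = 2 * p + 2" by simp
  then show "2 * p + 2 \<in> {graph_dist V E u v |u v. u \<in> V \<and> v \<in> V}" using uv by force
qed

section \<open>2-edge-connectivity by free edges, and the optimum\<close>

definition light_graph :: "nat set \<Rightarrow> nat set \<Rightarrow> edge set" where
  "light_graph x y = T \<union> {e \<in> E. weight x y e = 0}"

abbreviation conn :: "nat set \<Rightarrow> nat set \<Rightarrow> nat \<times> nat \<Rightarrow> nat \<times> nat \<Rightarrow> bool" where
  "conn x y a b \<equiv> bridgeless_conn (light_graph x y) (prod_encode a) (prod_encode b)"

lemma light_graph_subset: "light_graph x y \<subseteq> E"
  using T_subset by (auto simp: light_graph_def)

lemma light_arcI:
  assumes "(a, b) \<in> arcs" "\<not> (p + 2 \<le> fst a \<and> fst b = p)"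
  shows "{prod_encode a, prod_encode b} \<in> light_graph x y"
proof -
  have "(a, b) \<notin> heavy x y" using assms by (auto simp: heavy_def)
  moreover have "(b, a) \<notin> heavy x y"
    using assms(1) by (cases rule: arc_cases) (auto simp: heavy_def)
  ultimately have "weight x y {prod_encode a, prod_encode b} = 0"
    by (simp add: weight_def edge_graph_iff)
  moreover have "{prod_encode a, prod_encode b} \<in> E" using assms(1) by (simp add: E_def edge_graphI)
  ultimately show ?thesis by (simp add: light_graph_def)
qed

text \<open>The excluded arcs are the spokes, the only ones that can have weight 1.\<close>

definition light_arcs :: "((nat \<times> nat) \<times> (nat \<times> nat)) set" where
  "light_arcs = {(a, b) \<in> arcs. \<not> (p + 2 \<le> fst a \<and> fst b = p)}"

lemma arc_triangle:
  assumes "(a, b) \<in> light_arcs" "(a, c) \<in> light_arcs \<or> (c, a) \<in> light_arcs"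
    "(b, c) \<in> light_arcs \<or> (c, b) \<in> light_arcs"
  shows "conn x y a b"
proof (rule bridgeless_conn_triangle[of _ _ _ "prod_encode c"])
  have *: "{prod_encode u, prod_encode v} \<in> light_graph x y"
    if "(u, v) \<in> light_arcs \<or> (v, u) \<in> light_arcs" for u v
    using that light_arcI[of u v x y] light_arcI[of v u x y]
    by (auto simp: light_arcs_def insert_commute)
  show "{prod_encode a, prod_encode b} \<in> light_graph x y"
    "{prod_encode a, prod_encode c} \<in> light_graph x y"
    "{prod_encode c, prod_encode b} \<in> light_graph x y"
    using assms by (auto intro!: *)
  show "prod_encode c \<noteq> prod_encode a" "prod_encode c \<noteq> prod_encode b"
    using assms(2,3) arcs_in_verts[of a a] arcs_in_verts[of b b]
    by (auto simp: prod_encode_eq light_arcs_def)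
qed

text \<open>The third corner of the triangle is the first sibling or, for the first child itself,
  the second one, which exists as \<open>k \<ge> 2\<close>.\<close>

lemma conn_up:
  assumes "i < p" "j < k ^ Suc i"
  shows "conn x y (Suc i, j) (i, j div k)"
proof (cases "j mod k = 0")
  case False
  have "(j - j mod k) div k = j div k" by (simp add: minus_mod_eq_mult_div)
  moreover have "j - j mod k < k ^ Suc i" using assms by simp
  ultimately have "((Suc i, j - j mod k), (i, j div k)) \<in> arcs"
    using arcs.up[of i "j - j mod k"] assms by simp
  then show ?thesis
    using arcs.up[OF assms] arcs.sibling[OF assms False] assms
    by (intro arc_triangle[where c = "(Suc i, j - j mod k)"]) (auto simp: light_arcs_def)
next
  case True
  have mod1: "Suc j mod k = 1" using True k by (simp add: mod_Suc)
  have div1: "Suc j div k = j div k" using True k by (simp add: div_Suc mod_Suc)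
  \<comment> \<open>The row length is a multiple of \<open>k\<close>, so a first child is never last
    in its row.\<close>
  have "k dvd k ^ Suc i" "k dvd j" using True by auto
  then have "Suc j \<noteq> k ^ Suc i" using mod1 by (metis dvd_imp_mod_0 zero_neq_one)
  then have j: "Suc j < k ^ Suc i" using assms by simp
  have "((Suc i, Suc j), (Suc i, j)) \<in> arcs"
    using arcs.sibling[OF assms(1) j] mod1 by simp
  moreover have "((Suc i, Suc j), (i, j div k)) \<in> arcs"
    using arcs.up[OF assms(1) j] div1 by simp
  ultimately show ?thesis
    using arcs.up[OF assms] assms by (intro arc_triangle[where c = "(Suc i, Suc j)"]) (auto simp: light_arcs_def)
qed

lemma conn_tree: "i \<le> p \<Longrightarrow> j < k ^ i \<Longrightarrow> conn x y (0, 0) (i, j)"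
proof (induction i arbitrary: j)
  case (Suc i)
  have "j div k < k ^ i" using Suc.prems by (simp add: less_mult_imp_div_less mult.commute)
  then have "conn x y (0, 0) (i, j div k)" using Suc by simp
  then show ?case
    using Suc.prems by (intro bridgeless_conn_trans[OF _ bridgeless_conn_sym[OF conn_up]]) auto
qed (simp add: bridgeless_conn_refl)

lemma verts_row_down: "p < i \<Longrightarrow> (i, j) \<in> verts \<Longrightarrow> j' \<le> j \<Longrightarrow> (i, j') \<in> verts"
  by (auto simp: verts_def split: if_splits)

lemma verts_row_2: "p < i \<Longrightarrow> (i, j) \<in> verts \<Longrightarrow> (i, 2) \<in> verts"
  using p L_ge by (auto simp: verts_def split: if_splits)

text \<open>Each edge between consecutive vertices forms a triangle with the vertex before it or,
  for the first edge, the vertex after it.\<close>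

lemma conn_row: "p < i \<Longrightarrow> (i, j) \<in> verts \<Longrightarrow> conn x y (i, 0) (i, j)"
proof (induction j)
  case (Suc j)
  have "conn x y (i, Suc j) (i, j)"
  proof (cases j)
    case 0
    then have "(i, Suc (Suc j)) \<in> verts" using verts_row_2[OF Suc.prems] by (simp add: numeral_2_eq_2)
    then show ?thesis
      using arcs.step[OF Suc.prems(1), of j] arcs.step[OF Suc.prems(1), of "Suc j"]
        arcs.skip[OF Suc.prems(1), of j] Suc.prems
      by (intro arc_triangle[where c = "(i, Suc (Suc j))"]) (auto simp: light_arcs_def)
  next
    case (Suc j')
    then show ?thesis
      using arcs.step[OF Suc.prems(1), of j] arcs.step[OF Suc.prems(1), of j']
        arcs.skip[OF Suc.prems(1), of j'] Suc.prems verts_row_down[OF Suc.prems, of j]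
      by (intro arc_triangle[where c = "(i, j')"]) (auto simp: light_arcs_def)
  qed
  moreover have "conn x y (i, 0) (i, j)"
    using Suc.IH Suc.prems verts_row_down[OF Suc.prems, of j] by simp
  ultimately show ?case using bridgeless_conn_trans[OF _ bridgeless_conn_sym] by blast
qed (simp add: bridgeless_conn_refl)

lemma conn_tail: "conn x y (0, 0) (p + 1, 0)"
proof -
  have "((p + 1, Suc 0), (p + 1, 0)) \<in> arcs" using p by (intro arcs.step) (auto simp: verts_def)
  then have "conn x y (p + 1, 0) (0, 0)"
    using arcs.tail[of 0] arcs.tail[of 1] p by (intro arc_triangle[where c = "(p + 1, 1)"]) (auto simp: light_arcs_def)
  then show ?thesis by (rule bridgeless_conn_sym)
qed

lemma light_spoke:
  assumes "p + 2 \<le> i" "i < p + 2 + m" "j < k ^ p"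
    and "j = 0 \<or> j = 1 \<and> i - (p + 2) \<notin> x \<or> j = k ^ p - 1 \<and> i - (p + 2) \<notin> y"
  shows "{prod_encode (i, j), prod_encode (p, j)} \<in> light_graph x y"
proof -
  have "((i, j), (p, j)) \<notin> heavy x y" "((p, j), (i, j)) \<notin> heavy x y"
    using assms L_ge by (auto simp: heavy_def)
  then have "weight x y {prod_encode (i, j), prod_encode (p, j)} = 0"
    by (simp add: weight_def edge_graph_iff)
  moreover have "{prod_encode (i, j), prod_encode (p, j)} \<in> E"
    using arcs.spoke[OF assms(1-3)] by (simp add: E_def edge_graphI)
  ultimately show ?thesis by (simp add: light_graph_def)
qed

text \<open>Besides the tree edge at position 0, a player whose set omits the path provides a second
  free spoke.\<close>

lemma conn_path_row:
  assumes "p + 2 \<le> i" "i < p + 2 + m" "i - (p + 2) \<notin> x \<inter> y"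
  shows "conn x y (0, 0) (i, 0)"
proof -
  obtain j where j: "j = 1 \<and> i - (p + 2) \<notin> x \<or> j = k ^ p - 1 \<and> i - (p + 2) \<notin> y"
    using assms by blast
  then have jL: "j < k ^ p" "j \<noteq> 0" using L_ge by auto
  have "conn x y (i, 0) (p, 0)"
  proof (rule bridgeless_conn_two_edges)
    show "{prod_encode (i, 0), prod_encode (p, 0)} \<in> light_graph x y"
      using assms k by (intro light_spoke) auto
    show "{prod_encode (i, j), prod_encode (p, j)} \<in> light_graph x y"
      using assms j jL by (intro light_spoke) auto
    show "{prod_encode (i, 0), prod_encode (p, 0)} \<noteq> {prod_encode (i, j), prod_encode (p, j)}"
      using jL by (auto simp: doubleton_eq_iff prod_encode_eq)
    show "conn x y (i, 0) (i, j)"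
      using assms jL by (intro conn_row) (auto simp: verts_def)
    show "conn x y (p, 0) (p, j)"
      by (rule bridgeless_conn_trans[OF bridgeless_conn_sym[OF conn_tree] conn_tree]) (use jL k in auto)
  qed
  moreover have "conn x y (0, 0) (p, 0)" using k by (intro conn_tree) auto
  ultimately show ?thesis using bridgeless_conn_trans[OF _ bridgeless_conn_sym] by blast
qed

lemma conn_all:
  assumes "x \<inter> y = {}" "v \<in> verts"
  shows "conn x y (0, 0) v"
proof -
  obtain i j where v: "v = (i, j)" by (cases v)
  consider "i \<le> p" "j < k ^ i" | "i = p + 1" | "p + 2 \<le> i" "i < p + 2 + m"
    using assms(2) v by (fastforce simp: verts_def split: if_splits)
  then show ?thesis
  proof cases
    case 1
    then show ?thesis using conn_tree v by simp
  next
    case 2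
    then have "conn x y (i, 0) v" using conn_row assms v by simp
    then show ?thesis using conn_tail 2 bridgeless_conn_trans by blast
  next
    case 3
    then have "conn x y (i, 0) v" using conn_row assms v by simp
    then show ?thesis using conn_path_row 3 assms bridgeless_conn_trans by blast
  qed
qed

lemma two_edge_connected_light:
  assumes "x \<inter> y = {}" "\<Union> E' \<subseteq> V" "light_graph x y \<subseteq> E'"
  shows "two_edge_connected V E'"
proof (rule two_edge_connectedI[OF assms(2) _ assms(3)])
  show "bridgeless_conn (light_graph x y) root v" if "v \<in> V" for v
    using that conn_all[OF assms(1)] by (auto simp: V_def root_def)
qed

lemma tap_topology: "tap_topology V E T root"
  unfolding tap_topology_def
  using simple_graph_E spanning_tree_T root_V
    two_edge_connected_light[of "{}" "{}" E] Union_E light_graph_subset by simp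

lemma augmentation_light:
  assumes "x \<inter> y = {}"
  shows "augmentation V E T {e \<in> E. weight x y e = 0}"
  unfolding augmentation_def
  using two_edge_connected_light[OF assms, of "light_graph x y"] light_graph_subset Union_E
  by (auto simp: light_graph_def)

text \<open>A path that both players make expensive hangs on a single tree edge.\<close>

lemma augmentation_heavy:
  assumes l: "l \<in> x \<inter> y" "l < m" and Aug: "augmentation V E T Aug"
  shows "\<exists>e\<in>Aug. weight x y e \<noteq> 0"
proof (rule ccontr)
  assume "\<not> ?thesis"
  then have light: "e \<notin> edge_graph (heavy x y)" if "e \<in> Aug" for e
    using that by (auto simp: weight_def)
  define i where "i = p + 2 + l"
  define f where "f = {prod_encode (i, 0), prod_encode (p, 0)}"
  define S where "S = {prod_encode (i, j) | j. True}"
  have f: "f \<in> T"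
    unfolding f_def using tree_edgeI[of "(i, 0)"] l k by (simp add: i_def verts_def)
  have heavy: "((i, j), (p, j)) \<in> heavy x y" if "j < k ^ p" "j \<noteq> 0" for j
    using that l by (auto simp: heavy_def i_def)
  have notT: "{prod_encode (i, j), prod_encode (p, j)} \<notin> T" if "j \<noteq> 0" for j
    using that by (auto simp: T_def edge_graph_iff i_def)
  \<comment> \<open>Row \<open>i\<close> can be left only by spokes: the one at position 0 is
    \<open>f\<close>, and the others are heavy and outside \<open>T\<close>.\<close>
  have closed: "v \<in> S" if uv: "{u, v} \<in> T \<union> Aug - {f}" "u \<in> S" for u v
  proof -
    obtain j where u: "u = prod_encode (i, j)" using uv(2) by (auto simp: S_def)
    obtain b where v: "v = prod_encode b" by (metis prod_decode_inverse)
    have "{u, v} \<in> E" using uv T_subset Aug by (auto simp: augmentation_def)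
    then consider "((i, j), b) \<in> arcs" | "(b, (i, j)) \<in> arcs"
      by (auto simp: u v E_def edge_graph_iff)
    then show ?thesis
    proof cases
      case 1
      then show ?thesis
      proof (cases rule: arc_cases)
        case (spoke i' j')
        then have "{u, v} \<notin> T \<union> Aug - {f}"
          using notT[of j] light[of "{u, v}"] heavy[of j]
          by (cases "j = 0") (auto simp: u v f_def edge_graph_iff)
        then show ?thesis using uv by simp
      qed (auto simp: i_def S_def v)
    next
      case 2
      then show ?thesis by (cases rule: arc_cases) (auto simp: i_def S_def v)
    qed
  qed
  have "T \<union> Aug - {f} \<subseteq> E" using T_subset Aug by (auto simp: augmentation_def)
  then have "\<Union> (T \<union> Aug - {f}) \<subseteq> V" using Union_E by (meson Union_mono order_trans)
  moreover have "graph_connected V (T \<union> Aug - {f})"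
    using Aug f by (auto simp: augmentation_def two_edge_connected_def)
  moreover have "prod_encode (i, 0) \<in> V" "prod_encode (p, 0) \<in> V"
    using k l by (auto simp: V_def verts_def i_def)
  ultimately have "(prod_encode (i, 0), prod_encode (p, 0)) \<in> (adj (T \<union> Aug - {f}))\<^sup>*"
    by (simp add: graph_connected_iff)
  then have "prod_encode (p, 0) \<in> S"
  proof (induction rule: rtrancl_induct)
    case (step u v)
    then show ?case using closed by (simp add: adj_iff)
  qed (auto simp: S_def)
  then show False by (auto simp: S_def i_def prod_encode_eq)
qed

text \<open>The positions of the paths that lie below a vertex form the interval \<open>{lo v..<hi v}\<close>; the vertices
  of the tail get all positions, like the root.\<close>

fun lo :: "nat \<times> nat \<Rightarrow> nat" where
  "lo (i, j) = (if i \<le> p then j * k ^ (p - i) else if i = p + 1 then 0 else j)"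

fun hi :: "nat \<times> nat \<Rightarrow> nat" where
  "hi (i, j) = (if i \<le> p then Suc j * k ^ (p - i) else if i = p + 1 then k ^ p else Suc j)"

text \<open>Both fronts move 2 positions per round, the speed of a \<open>skip\<close> arc. At time
  0, \<open>early\<close> omits only vertices at position \<open>k ^ p - 1\<close>, and
  \<open>late\<close> only those with no position above 1. An inner tree vertex is judged by its
  leftmost position here and by its rightmost one in \<open>late\<close>, so it may well lie in both
  sets.\<close>

definition early :: "nat \<Rightarrow> nat set" where
  "early t = {v. lo (prod_decode v) + 2 * t + 1 < k ^ p}"

definition late :: "nat \<Rightarrow> nat set" where
  "late t = {v. 2 * t + 2 < hi (prod_decode v)}"

text \<open>Arcs among the tree vertices directly below the tree vertex over position \<open>q\<close>, and between
  them and that vertex.\<close>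

definition crossing :: "nat \<Rightarrow> ((nat \<times> nat) \<times> (nat \<times> nat)) set" where
  "crossing q = (\<lambda>(i, r, s). let h = q div k ^ (p - i); c = (Suc i, h * k + r); f = (Suc i, h * k)
     in if s = 0 then (c, (i, h)) else if s = 1 then (c, f) else (f, c)) ` ({..<p} \<times> {..<k} \<times> {..<3 :: nat})"

lemma finite_crossing: "finite (crossing q)"
  by (simp add: crossing_def)

lemma card_crossing: "card (crossing q) \<le> 3 * p * k"
proof -
  have "card (crossing q) \<le> card ({..<p} \<times> {..<k} \<times> {..<3 :: nat})"
    unfolding crossing_def by (rule card_image_le) simp
  then show ?thesis by (simp add: card_cartesian_product mult_ac)
qed

lemma crossing_child:
  assumes "i < p" "(j div k) * k ^ (p - i) \<le> q" "q < Suc (j div k) * k ^ (p - i)"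
  shows "((Suc i, j), (i, j div k)) \<in> crossing q" "((Suc i, j), (Suc i, j - j mod k)) \<in> crossing q"
    "((Suc i, j - j mod k), (Suc i, j)) \<in> crossing q"
proof -
  have h: "q div k ^ (p - i) = j div k"
    using assms k by (intro div_nat_eqI) (auto simp: mult.commute)
  have j: "(j div k) * k + j mod k = j" "(j div k) * k = j - j mod k" "j mod k < k"
    using k by (auto simp: minus_mod_eq_div_mult)
  show "((Suc i, j), (i, j div k)) \<in> crossing q"
    unfolding crossing_def by (rule image_eqI[of _ _ "(i, j mod k, 0)"]) (use assms j in \<open>auto simp: h Let_def\<close>)
  show "((Suc i, j), (Suc i, j - j mod k)) \<in> crossing q"
    unfolding crossing_def by (rule image_eqI[of _ _ "(i, j mod k, 1)"]) (use assms j in \<open>auto simp: h Let_def\<close>)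
  show "((Suc i, j - j mod k), (Suc i, j)) \<in> crossing q"
    unfolding crossing_def by (rule image_eqI[of _ _ "(i, j mod k, 2)"]) (use assms j in \<open>auto simp: h Let_def\<close>)
qed

section \<open>Position intervals along arcs, and the arcs that cross a front\<close>

lemma power_split: "i < p \<Longrightarrow> k ^ (p - i) = k * k ^ (p - Suc i)"
  by (metis Suc_diff_Suc power_Suc)

lemma lo_up: "i < p \<Longrightarrow> lo (i, j div k) \<le> lo (Suc i, j)"
proof -
  assume "i < p"
  have "(j div k * k) * k ^ (p - Suc i) \<le> j * k ^ (p - Suc i)"
    by (intro mult_right_mono) auto
  then show ?thesis using \<open>i < p\<close> by (simp add: power_split mult.assoc)
qed

lemma hi_up: "i < p \<Longrightarrow> hi (Suc i, j) \<le> hi (i, j div k)"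
proof -
  assume "i < p"
  have "Suc j \<le> Suc (j div k) * k" using k dividend_less_div_times[of k j] by simp
  then have "Suc j * k ^ (p - Suc i) \<le> (Suc (j div k) * k) * k ^ (p - Suc i)"
    by (intro mult_right_mono) auto
  then show ?thesis using \<open>i < p\<close> by (simp add: power_split algebra_simps)
qed

lemma lo_less_hi: "lo v < hi v"
  using k by (cases v) auto

lemma lo_first: "i < p \<Longrightarrow> lo (Suc i, j - j mod k) = lo (i, j div k)"
  by (simp add: power_split minus_mod_eq_div_mult)

lemma lo_arc:
  assumes "(a, b) \<in> arcs"
  shows "lo b \<le> lo a"
  using assms
proof (cases rule: arc_cases)
  case (up i j)
  then show ?thesis using lo_up by simp
next
  case (sibling i j)
  have "lo b = lo (i, j div k)" using lo_first[of i j] sibling by simp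
  also have "\<dots> \<le> lo a" using lo_up[of i j] sibling by simp
  finally show ?thesis .
qed auto

text \<open>Arcs inside a path change \<open>lo\<close> by at most 2, spokes and tail arcs not at
  all, so only arcs of the tree can jump over \<open>q\<close>. The parent involved then has
  \<open>q\<close> in its interval, which singles out one vertex per level.\<close>

lemma lo_crossing:
  assumes "(a, b) \<in> arcs" "lo b + 2 < q" "q \<le> lo a"
  shows "(a, b) \<in> crossing q"
  using assms(1)
proof (cases rule: arc_cases)
  case (up i j)
  have "lo (i, j div k) \<le> q" "q < hi (i, j div k)"
    using assms up lo_less_hi[of a] hi_up[of i j] by (auto simp del: lo.simps hi.simps)
  then show ?thesis using crossing_child(1)[of i j q] up by simp
next
  case (sibling i j)
  have "lo (i, j div k) \<le> q" "q < hi (i, j div k)"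
    using assms sibling lo_first[of i j] lo_less_hi[of a] hi_up[of i j] by (auto simp del: lo.simps hi.simps)
  then show ?thesis using crossing_child(2)[of i j q] sibling by simp
qed (use assms in \<open>auto split: if_splits\<close>)

lemma hi_crossing:
  assumes "(a, b) \<in> arcs" "hi a \<le> q" "q + 2 < hi b"
  shows "(a, b) \<in> crossing q"
  using assms(1)
proof (cases rule: arc_cases)
  case (up i j)
  have "lo (i, j div k) \<le> q" "q < hi (i, j div k)"
    using assms up lo_less_hi[of a] lo_up[of i j] by (auto simp del: lo.simps hi.simps)
  then show ?thesis using crossing_child(1)[of i j q] up by simp
next
  case (sibling i j)
  have "hi b \<le> hi a" unfolding sibling using sibling by (auto intro!: mult_right_mono)
  then show ?thesis using assms by simp
qed (use assms in \<open>auto split: if_splits\<close>)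

text \<open>Unlike \<open>lo\<close>, \<open>hi\<close> is not monotone along arcs: it does not
  decrease towards the parent but can decrease towards the first sibling. Hence the reversed sibling
  arcs in \<open>crossing\<close>.\<close>

lemma hi_crossing_rev:
  assumes "(a, b) \<in> arcs" "hi b \<le> q" "q + 2 < hi a"
  shows "(b, a) \<in> crossing q"
  using assms(1)
proof (cases rule: arc_cases)
  case (up i j)
  then show ?thesis using hi_up[of i j] assms by (simp del: hi.simps)
next
  case (sibling i j)
  have "lo (i, j div k) \<le> q" "q < hi (i, j div k)"
    using assms sibling lo_first[of i j] lo_less_hi[of b] hi_up[of i j] by (auto simp del: lo.simps hi.simps)
  then show ?thesis using crossing_child(3)[of i j q] sibling by simp
qed (use assms in \<open>auto split: if_splits\<close>)

lemma card_boundary: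
  "card {(u, v). {u, v} \<in> E \<and>
      (v \<in> early (Suc t) \<and> u \<notin> early t \<or> v \<in> late (Suc t) \<and> u \<notin> late t)} \<le> 6 * p * k"
    (is "card ?X \<le> _")
proof -
  \<comment> \<open>A message from outside \<open>early t\<close> into \<open>early (Suc t)\<close>
    has to jump over position \<open>k ^ p - 2 * t - 1\<close> by more than 2; for
    \<open>late\<close> that position is \<open>2 * t + 2\<close>.\<close>
  define Y where "Y = map_prod prod_encode prod_encode ` (crossing (k ^ p - 2 * t - 1) \<union> crossing (2 * t + 2))"
  have "?X \<subseteq> Y"
  proof (rule subrelI)
    fix u v assume uv: "(u, v) \<in> ?X"
    define a b where "a = prod_decode u" and "b = prod_decode v"
    have ab: "(a, b) \<in> arcs \<or> (b, a) \<in> arcs"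
      using uv edge_graph_iff[of a b arcs] by (simp add: E_def a_def b_def)
    have "(a, b) \<in> crossing (k ^ p - 2 * t - 1) \<union> crossing (2 * t + 2)"
    proof (cases "v \<in> early (Suc t) \<and> u \<notin> early t")
      case True
      then have *: "lo b + 2 < k ^ p - 2 * t - 1" "k ^ p - 2 * t - 1 \<le> lo a"
        by (auto simp: early_def a_def b_def)
      then have "(a, b) \<in> arcs" using ab lo_arc[of b a] by auto
      then show ?thesis using lo_crossing * by blast
    next
      case False
      then have *: "hi a \<le> 2 * t + 2" "2 * t + 2 + 2 < hi b"
        using uv by (auto simp: late_def a_def b_def)
      then show ?thesis using ab hi_crossing hi_crossing_rev by blast
    qed
    then have "map_prod prod_encode prod_encode (a, b) \<in> Y" unfolding Y_def by (rule imageI)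
    then show "(u, v) \<in> Y" by (simp add: a_def b_def)
  qed
  then have "card ?X \<le> card Y" by (intro card_mono) (auto simp: Y_def finite_crossing)
  also have "\<dots> \<le> card (crossing (k ^ p - 2 * t - 1) \<union> crossing (2 * t + 2))"
    unfolding Y_def by (intro card_image_le) (auto simp: finite_crossing)
  also have "\<dots> \<le> card (crossing (k ^ p - 2 * t - 1)) + card (crossing (2 * t + 2))"
    by (rule card_Un_le)
  also have "\<dots> \<le> 6 * p * k"
    using card_crossing[of "k ^ p - 2 * t - 1"] card_crossing[of "2 * t + 2"] by simp
  finally show ?thesis .
qed

text \<open>A vertex outside both sets would have \<open>k ^ p - 2 * t - 1 \<le> lo\<close> and
  \<open>hi \<le> 2 * t + 2\<close>. The fronts close in by 4 positions per round, which is the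
  source of the bound on \<open>R\<close>.\<close>

lemma early_late_cover:
  assumes "4 * t + 3 \<le> k ^ p"
  shows "v \<in> early t \<union> late t"
  using lo_less_hi[of "prod_decode v"] assms by (auto simp: early_def late_def)

lemma weight_early:
  assumes "v \<in> early 0" "v \<in> e"
  shows "weight x y e = weight x y' e"
proof -
  have "e \<in> edge_graph (heavy x y2)" if "e \<in> edge_graph (heavy x y1)" for y1 y2
  proof -
    obtain i j where h: "((i, j), (p, j)) \<in> heavy x y1" "e = {prod_encode (i, j), prod_encode (p, j)}"
      using \<open>e \<in> edge_graph (heavy x y1)\<close> by (auto simp: edge_graph_def heavy_def)
    have "j \<noteq> k ^ p - 1" using assms h by (auto simp: early_def heavy_def)
    then have "((i, j), (p, j)) \<in> heavy x y2" using h(1) by (auto simp: heavy_def)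
    then show ?thesis unfolding h(2) by (rule edge_graphI)
  qed
  then show ?thesis by (auto simp: weight_def)
qed

lemma weight_late:
  assumes "v \<in> late 0" "v \<in> e"
  shows "weight x y e = weight x' y e"
proof -
  have "e \<in> edge_graph (heavy x2 y)" if "e \<in> edge_graph (heavy x1 y)" for x1 x2
  proof -
    obtain i j where h: "((i, j), (p, j)) \<in> heavy x1 y" "e = {prod_encode (i, j), prod_encode (p, j)}"
      using \<open>e \<in> edge_graph (heavy x1 y)\<close> by (auto simp: edge_graph_def heavy_def)
    have "j \<noteq> 1" using assms h by (auto simp: late_def heavy_def)
    then have "((i, j), (p, j)) \<in> heavy x2 y" using h(1) by (auto simp: heavy_def)
    then show ?thesis unfolding h(2) by (rule edge_graphI)
  qed
  then show ?thesis by (auto simp: weight_def)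
qed

lemma round_lower_bound:
  fixes \<epsilon> :: real
  assumes "\<epsilon> < 1 / 2" "W \<ge> 1" "bandwidth B A" "B \<ge> 1"
    and "approximates_in_rounds V E T root W a \<epsilon> A R"
    and large: "640 * (k * p * B * k ^ p) < m * (1 - 2 * \<epsilon>)\<^sup>2"
  shows "k ^ p \<le> 4 * R + 2"
proof (rule ccontr)
  assume "\<not> ?thesis"
  then have R: "4 * R + 3 \<le> k ^ p" by simp
  have "card {..<m} * (1 - 2 * \<epsilon>)\<^sup>2 \<le> 128 * ((real (6 * p * k) * R * (real B + 1) + 2) * ln 2)"
  proof (rule moving_cut_lower_bound[where P = early and Q = late and w = weight])
    show "V \<subseteq> early t \<union> late t" if "t \<le> R" for t
      using early_late_cover[of t] that R by auto
    show "card {(u, v). {u, v} \<in> E \<and>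
        (v \<in> early (Suc t) \<and> u \<notin> early t \<or> v \<in> late (Suc t) \<and> u \<notin> late t)} \<le> 6 * p * k" for t
      by (rule card_boundary)
    show "augmentation V E T {e \<in> E. weight x y e = 0}" if "x \<inter> y = {}" for x y
      by (rule augmentation_light[OF that])
    show "\<exists>e\<in>Aug. weight x y e \<noteq> 0"
      if "x \<subseteq> {..<m}" "x \<inter> y \<noteq> {}" "augmentation V E T Aug" for x y Aug
      using augmentation_heavy[of _ x y Aug] that by blast
  qed (use assms simple_graph_E weight_early weight_late in
      \<open>auto simp: early_def late_def weight_def\<close>)
  also have "\<dots> \<le> 128 * ((real (6 * p * k) * R * (real B + 1) + 2) * 1)"
    using ln_2_less_1 by (intro mult_left_mono) auto
  also have "\<dots> \<le> 128 * (5 * real (k * p * B * k ^ p))"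
  proof -
    \<comment> \<open>From \<open>B + 1 \<le> 2 * B\<close> and \<open>4 * R \<le> k ^ p\<close> one
      gets \<open>6 * X \<le> 3 * Y\<close>, and the constant 2 is at most \<open>2 * Y\<close>.
      With the factor 128 this is the 640 of \<open>large\<close>.\<close>
    define X Y where "X = p * k * (R * (B + 1))" and "Y = k * p * B * k ^ p"
    have "4 * X \<le> 2 * Y"
    proof -
      have "R * (B + 1) * 4 \<le> R * (2 * B) * 4" using \<open>B \<ge> 1\<close> by (intro mult_right_mono mult_left_mono) auto
      also have "\<dots> = 2 * B * (4 * R)" by simp
      also have "\<dots> \<le> 2 * B * k ^ p" using R by (intro mult_left_mono) auto
      finally have "p * k * (R * (B + 1) * 4) \<le> p * k * (2 * B * k ^ p)" by (rule mult_left_mono) simp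
      then show ?thesis unfolding X_def Y_def by (simp only: mult_ac)
    qed
    moreover have "1 \<le> Y" unfolding Y_def using k p \<open>B \<ge> 1\<close> by (auto simp: Suc_le_eq)
    ultimately have "6 * X + 2 \<le> 5 * Y" by linarith
    then have "6 * p * k * R * (B + 1) + 2 \<le> 5 * (k * p * B * k ^ p)"
      by (simp only: X_def Y_def mult.assoc)
    then have "real (6 * p * k * R * (B + 1) + 2) \<le> real (5 * (k * p * B * k ^ p))"
      by (rule of_nat_mono)
    then show ?thesis by (simp add: algebra_simps)
  qed
  finally show False using large by simp
qed

end

theorem theorem8:
  fixes \<epsilon> :: real
  assumes "0 \<le> \<epsilon>" and "\<epsilon> < 1/2"
  shows "\<exists>c\<^sub>1>0. \<exists>c\<^sub>2>0. \<exists>c\<^sub>3>0. \<exists>c\<^sub>4>0.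
    \<forall>(\<alpha> :: real poly) (p :: nat) (B :: nat) (n :: nat).
      p > 1 \<longrightarrow> B \<ge> 1 \<longrightarrow> n \<in> {k ^ (2 * p + 1) * p * B | k. k \<ge> 2} \<longrightarrow>
      (\<exists>V E T r.
         tap_topology V E T r \<and>
         c\<^sub>1 * real n \<le> real (card V) \<and> real (card V) \<le> c\<^sub>2 * real n \<and>
         graph_diameter V E = 2 * p + 2 \<and>
         (\<forall>A R W. bandwidth B A \<longrightarrow> W \<ge> 1 \<longrightarrow>
            approximates_in_rounds V E T r W (poly \<alpha> (real (card V))) \<epsilon> A R \<longrightarrow>
            real R \<ge> c\<^sub>3 * (real n / (real p * real B)) powr (1/2 - 1 / (2 * (2 * real p + 1)))) \<and>
         (real n / (real p * real B)) powr (1/2 - 1 / (2 * (2 * real p + 1)))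
           \<ge> c\<^sub>4 * real (tree_height V T r))"
proof -
  define \<delta> where "\<delta> = (1 - 2 * \<epsilon>)\<^sup>2"
  have "\<delta> > 0" using assms by (simp add: \<delta>_def)
  \<comment> \<open>The multiplier depends on \<open>\<epsilon>\<close> alone, so the constants are
    uniform in \<open>\<alpha>\<close>, \<open>p\<close>, \<open>B\<close> and
    \<open>n\<close>.\<close>
  then obtain N :: nat where "640 / \<delta> < N" using reals_Archimedean2 by blast
  then have N: "640 < N * \<delta>" using \<open>\<delta> > 0\<close> by (simp add: field_simps)
  then have N1: "N \<ge> 1" by (cases N) auto
  show ?thesis
  \<comment> \<open>In \<open>N + 5\<close> the paths account for \<open>N\<close>, the tree for 2
    and the tail for 3. The 1/8 absorbs the additive 2 of \<open>k ^ p \<le> 4 * R + 2\<close>, and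
    1/2 comes from the height bound \<open>2 * k ^ p\<close>.\<close>
  proof (rule exI[of _ "1::real"], rule conjI, simp, rule exI[of _ "real N + 5"], rule conjI, simp,
      rule exI[of _ "1/8::real"], rule conjI, simp, rule exI[of _ "1/2::real"], rule conjI, simp,
      intro allI impI)
    fix \<alpha> :: "real poly" and p B n :: nat
    assume p: "p > 1" and B: "B \<ge> 1" and "n \<in> {k ^ (2 * p + 1) * p * B | k. k \<ge> 2}"
    then obtain k where k: "k \<ge> 2" and n: "n = k ^ (2 * p + 1) * p * B" by blast
    \<comment> \<open>A multiple of the number of bits that can cross the fronts; at the same time
      \<open>m * k ^ p\<close> is exactly \<open>N * n\<close>.\<close>
    define m where "m = N * (k * p * B * k ^ p)"
    have m: "m \<ge> 1" using N1 k p B by (auto simp: m_def Suc_le_eq)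
    interpret tap_family k p m using k p m by unfold_locales auto
    have mL: "m * k ^ p = N * n"
      by (simp add: m_def n power_add power_mult mult_ac power2_eq_square flip: power_mult_distrib)
    have n_ge: "p * k ^ p \<le> n"
    proof -
      have "p * k ^ p = 1 * p * k ^ p * 1" by simp
      also have "\<dots> \<le> k ^ Suc p * p * k ^ p * B"
        using k B by (intro mult_mono) auto
      also have "\<dots> = n" by (simp add: n power_add power_mult mult_ac power2_eq_square flip: power_mult_distrib)
      finally show ?thesis .
    qed
    \<comment> \<open>The exponent equals p/(2p+1) and so takes \<open>k ^ (2 * p + 1)\<close> to
      \<open>k ^ p\<close>.\<close>
    have pow: "(real n / (real p * real B)) powr (1/2 - 1 / (2 * (2 * real p + 1))) = real (k ^ p)"
    proof -
      have "real n / (real p * real B) = real k powr real (2 * p + 1)"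
        using k p B by (subst powr_realpow) (auto simp: n)
      moreover have "real (2 * p + 1) * (1/2 - 1 / (2 * (2 * real p + 1))) = real p"
        by (simp add: field_simps)
      ultimately have "(real n / (real p * real B)) powr (1/2 - 1 / (2 * (2 * real p + 1))) = real k powr real p"
        by (simp only: powr_powr)
      then show ?thesis using k by (simp add: powr_realpow)
    qed
    have "real (m * k ^ p) \<le> real (card V)" using card_V(1) by (rule of_nat_mono)
    moreover have "real n \<le> real N * real n" using N1 by (simp add: mult_le_cancel_right1)
    ultimately have card1: "1 * real n \<le> real (card V)" unfolding mL by simp
    have "card V \<le> (N + 5) * n"
    proof -
      have "(p + 1) * k ^ p \<le> 2 * (p * k ^ p)" using p by simp
      moreover have "2 * p + 1 \<le> 3 * (p * k ^ p)"
      proof -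
        have "p * 1 \<le> p * k ^ p" using L_ge by (intro mult_left_mono) auto
        then show ?thesis using p by linarith
      qed
      ultimately show ?thesis using card_V(2) n_ge unfolding mL add_mult_distrib by linarith
    qed
    then have "real (card V) \<le> real ((N + 5) * n)" by (rule of_nat_mono)
    then have card2: "real (card V) \<le> (real N + 5) * real n" by simp
    have large: "640 * (k * p * B * k ^ p) < m * (1 - 2 * \<epsilon>)\<^sup>2"
    proof -
      have "0 < real (k * p * B * k ^ p)" using k p B by simp
      from mult_strict_right_mono[OF N this] show ?thesis by (simp add: m_def \<delta>_def mult_ac)
    qed
    have rounds: "1 / 8 * real (k ^ p) \<le> real R"
      if "bandwidth B A" "W \<ge> 1" "approximates_in_rounds V E T root W a \<epsilon> A R" for A R W a
    proof -
      have "k ^ p \<le> 4 * R + 2" using round_lower_bound[OF assms(2) that(2,1) B that(3) large] .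
      then have "k ^ p \<le> 8 * R" using L_ge by simp
      then have "real (k ^ p) \<le> real (8 * R)" by (rule of_nat_mono)
      then show ?thesis by simp
    qed
    have "real (tree_height V T root) \<le> real (2 * k ^ p)" using tree_height_le by (rule of_nat_mono)
    then have height: "1 / 2 * real (tree_height V T root) \<le> real (k ^ p)" by simp
    show "\<exists>V E T r.
         tap_topology V E T r \<and>
         1 * real n \<le> real (card V) \<and> real (card V) \<le> (real N + 5) * real n \<and>
         graph_diameter V E = 2 * p + 2 \<and>
         (\<forall>A R W. bandwidth B A \<longrightarrow> W \<ge> 1 \<longrightarrow>
            approximates_in_rounds V E T r W (poly \<alpha> (real (card V))) \<epsilon> A R \<longrightarrow>
            real R \<ge> 1 / 8 * (real n / (real p * real B)) powr (1/2 - 1 / (2 * (2 * real p + 1)))) \<and>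
         (real n / (real p * real B)) powr (1/2 - 1 / (2 * (2 * real p + 1)))
           \<ge> 1 / 2 * real (tree_height V T r)"
      unfolding pow
      using tap_topology card1 card2 graph_diameter_eq rounds height by blast
  qed
qed

end
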